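(* Let $\beta > 1$ be a root of $x^3 - m x^2 - m x - m$, where $m \ge 1$ is an integer. Then \[ \max\{\operatorname{fr}(x\pm y):\, x, y \in \mathbb{Z}_{-\beta}\} = 3m + \begin{cases} 3 & \mbox{if $m=1$ or $m$ is even}, \\ 4 & \mbox{if $m \ge 3$ is odd}, \end{cases} \] where the maximum is over all $x,y\in\mathbb{Z}_{-\beta}$ and both signs.
   Context: For a real number $\beta>1$, set $\ell_\beta = \frac{-\beta}{\beta+1}$ and define the $(-\beta)$-transformation $T_{-\beta}: [\ell_\beta,\ell_\beta+1)\to[\ell_\beta,\ell_\beta+1)$ by $T_{-\beta}(x) = -\beta x - \lfloor -\beta x-\ell_\beta\rfloor$. For $x\in[\ell_\beta,\ell_\beta+1)$ let $d_{-\beta}(x)=x_1x_2x_3\cdots$ with $x_i = \lfloor -\beta T_{-\beta}^{i-1}(x)-\ell_\beta\rfloor\in\{0,1,\dots,\lfloor\beta\rfloor\}$, so that $x=\sum_{i\ge1} x_i(-\beta)^{-i}$. For $x\in\mathbb{R}$, let $k\ge 0$ be the minimal integer with $\frac{x}{(-\beta)^k}\in(\ell_\beta,\ell_\beta+1)$ and let $d_{-\beta}(\frac{x}{(-\beta)^k})=x_1x_2x_3\cdots$; the $(-\beta)$-expansion of $x$ is $x_1\cdots x_k\bullet x_{k+1}x_{k+2}\cdots$ if $k\ge1$ and $0\bullet x_1x_2\cdots$ if $k=0$. The set $\mathbb{Z}_{-\beta}$ of $(-\beta)$-integers consists of the $x\in\mathbb{R}$ whose $(-\beta)$-expansion has only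 zeros after the point $\bullet$; equivalently $\mathbb{Z}_{-\beta}=\bigcup_{k\ge0}(-\beta)^kT_{-\beta}^{-k}(0)$, with $T_{-\beta}^{-k}(0)$ the preimage of $0$ under $T_{-\beta}^k$. If the $(-\beta)$-expansion of $x$ is $x_1\cdots x_k\bullet x_{k+1}\cdots x_{k+n}0^\omega$ with $x_{k+n}\ne0$, $n\ge1$ (finite expansion), then $\operatorname{fr}(x)=n$ is the length of the fractional part of $x$; if $x\in\mathbb{Z}_{-\beta}$, then $\operatorname{fr}(x)=0$. *)

theory Defs
  imports Complex_Main
begin

text \<open>
  Throughout, the base is \<open>-\<beta>\<close> for a real \<open>\<beta> > 1\<close>; the parameter of all constants below is \<open>\<beta>\<close>.
  The transformation is a total function on the reals, but it is only ever iterated on points of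
  the interval \<open>{ell \<beta>..<ell \<beta> + 1}\<close>, which it maps to itself.
\<close>

definition ell :: "real \<Rightarrow> real" where
  "ell \<beta> = - \<beta> / (\<beta> + 1)"

definition neg_beta_T :: "real \<Rightarrow> real \<Rightarrow> real" where
  "neg_beta_T \<beta> x = - \<beta> * x - of_int \<lfloor>- \<beta> * x - ell \<beta>\<rfloor>"

text \<open>Digits are indexed from 1; the value at index 0 is irrelevant.\<close>

definition neg_beta_digit :: "real \<Rightarrow> real \<Rightarrow> nat \<Rightarrow> int" where
  "neg_beta_digit \<beta> x i = \<lfloor>- \<beta> * (neg_beta_T \<beta> ^^ (i - 1)) x - ell \<beta>\<rfloor>"

text \<open>
  The number \<open>k\<close> of places before the point. Such a \<open>k\<close> exists for every real \<open>x\<close> when \<open>\<beta> > 1\<close>, since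
  the open interval contains 0. For \<open>k = 0\<close> the integer part is the single digit 0, so that in
  either case the digit at position \<open>i\<close> after the point is the one with index \<open>k + i\<close>.
\<close>

definition neg_beta_shift :: "real \<Rightarrow> real \<Rightarrow> nat" where
  "neg_beta_shift \<beta> x = (LEAST k. x / (- \<beta>) ^ k \<in> {ell \<beta><..<ell \<beta> + 1})"

definition neg_beta_frac_digit :: "real \<Rightarrow> real \<Rightarrow> nat \<Rightarrow> int" where
  "neg_beta_frac_digit \<beta> x i =
     (let k = neg_beta_shift \<beta> x in neg_beta_digit \<beta> (x / (- \<beta>) ^ k) (k + i))"

definition neg_beta_integers :: "real \<Rightarrow> real set" where
  "neg_beta_integers \<beta> = {x. \<forall>i\<ge>1. neg_beta_frac_digit \<beta> x i = 0}"

definition finite_neg_beta_expansion :: "real \<Rightarrow> real \<Rightarrow> bool" where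
  "finite_neg_beta_expansion \<beta> x \<longleftrightarrow> (\<exists>n. \<forall>i>n. neg_beta_frac_digit \<beta> x i = 0)"

text \<open>Meaningful only if the expansion of \<open>x\<close> is finite; otherwise the value is unspecified.\<close>

definition fr :: "real \<Rightarrow> real \<Rightarrow> nat" where
  "fr \<beta> x =
     (if x \<in> neg_beta_integers \<beta> then 0
      else (THE n. n \<ge> 1 \<and> neg_beta_frac_digit \<beta> x n \<noteq> 0 \<and>
                   (\<forall>i>n. neg_beta_frac_digit \<beta> x i = 0)))"

end

theory Submission
  imports Defs
begin

text \<open>
  If \<open>x = y + z\<close> for three points of the interval \<open>[\<ell>, \<ell> + 1)\<close>, then the difference of the
  states \<open>T\<^sup>n x - T\<^sup>n y - T\<^sup>n z\<close> always lies in \<open>\<int>[\<beta>]\<close> and can be written as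
  \<open>lin a b c = (m / \<beta>) a - (\<beta> - m) b + c\<close> with integers \<open>a, b, c\<close>. In these coordinates one step
  of \<open>T\<close> shifts the window \<open>(a, b, c)\<close> to \<open>(b, c, e)\<close>, where \<open>a - b + c\<close> stays in \<open>{-1..2}\<close>; up to
  this small error the shift is a rotation of order 6. The bounds on the digits and on the real value
  confine \<open>(a, b)\<close> to a hexagon of size \<open>m + 1\<close>. For \<open>x, y \<in> \<int>\<^sub>-\<^sub>\<beta>\<close> the fractional part of
  \<open>x \<plusminus> y\<close> is therefore the expansion of some \<open>lin a b c\<close> with \<open>(a, b)\<close> in the hexagon, on which
  \<open>T\<close> becomes an explicit map of integer pairs. It spirals to \<open>(0, 0)\<close>, losing about 2 in size
  every 6 steps, and an integer potential counts the steps.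

  The maximum is attained by differences of two \<open>(-\<beta>)\<close>-integers whose digits make the window spiral
  outwards from \<open>(0, 0, -1)\<close> in blocks of six digits up to the boundary of the hexagon (for \<open>m = 1\<close>,
  by \<open>1 + (1 - \<beta>)\<close>).
\<close>

section \<open>The \<open>(-\<beta>)\<close>-transformation\<close>

abbreviation "unit_ivl \<beta> \<equiv> {ell \<beta>..<ell \<beta> + 1}"
abbreviation "open_ivl \<beta> \<equiv> {ell \<beta><..<ell \<beta> + 1}"

lemma ell_bounds:
  assumes "\<beta> > 1"
  shows "-1 < ell \<beta>" "ell \<beta> < 0"
  using assms by (simp_all add: ell_def field_simps)

lemma neg_beta_T_range: "neg_beta_T \<beta> x \<in> unit_ivl \<beta>"
  unfolding neg_beta_T_def by (auto; linarith)

lemma neg_beta_T_eqI: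
  assumes "- \<beta> * x = of_int d + v" "v \<in> unit_ivl \<beta>"
  shows "neg_beta_T \<beta> x = v"
proof -
  have "\<lfloor>of_int d + v - ell \<beta>\<rfloor> = d"
    using assms(2) by (intro floor_unique) auto
  then show ?thesis unfolding neg_beta_T_def assms(1) by simp
qed

lemma neg_beta_T_0:
  assumes "\<beta> > 1"
  shows "neg_beta_T \<beta> 0 = 0"
  using ell_bounds[OF assms] by (intro neg_beta_T_eqI[where d = 0]) auto

lemma neg_beta_T_pow_0:
  assumes "\<beta> > 1"
  shows "(neg_beta_T \<beta> ^^ n) 0 = 0"
  using neg_beta_T_0[OF assms] by (induction n) auto

lemma neg_beta_T_pow_range:
  "x \<in> unit_ivl \<beta> \<Longrightarrow> (neg_beta_T \<beta> ^^ n) x \<in> unit_ivl \<beta>"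
  using neg_beta_T_range by (cases n) auto

lemma neg_beta_T_pow_eq_0_mono:
  assumes "\<beta> > 1" "(neg_beta_T \<beta> ^^ n) x = 0" "n \<le> k"
  shows "(neg_beta_T \<beta> ^^ k) x = 0"
proof -
  have "neg_beta_T \<beta> ^^ k = (neg_beta_T \<beta> ^^ (k - n)) \<circ> (neg_beta_T \<beta> ^^ n)"
    using assms(3) by (metis funpow_add le_add_diff_inverse2)
  then show ?thesis using assms neg_beta_T_pow_0 by simp
qed

text \<open>Division by -\<beta> would send \<open>ell \<beta>\<close> to
  \<open>ell \<beta> + 1\<close>, outside the half-open interval; hence the open one. The bound at
  the other end amounts to \<open>\<beta> * \<beta> > 1\<close>.\<close>

lemma open_ivl_div:
  assumes "\<beta> > 1" "v \<in> open_ivl \<beta>"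
  shows "v / - \<beta> \<in> open_ivl \<beta>"
proof -
  have "v > - \<beta> / (\<beta> + 1)" "v < 1 / (\<beta> + 1)"
    using assms by (simp_all add: ell_def field_simps)
  then have "v * (\<beta> + 1) > - \<beta>" "v * (\<beta> + 1) < 1"
    using assms(1) by (simp_all add: field_simps)
  moreover have "\<beta> * \<beta> > 1" using assms(1) by (simp add: less_1_mult)
  ultimately show ?thesis
    using assms(1) by (simp add: ell_def field_simps)
qed

lemma neg_beta_T_div:
  assumes "\<beta> > 1" "v \<in> open_ivl \<beta>"
  shows "neg_beta_T \<beta> (v / - \<beta>) = v"
  using assms by (intro neg_beta_T_eqI[where d = 0]) auto

lemma neg_beta_T_pow_div:
  assumes "\<beta> > 1" "v \<in> open_ivl \<beta>"
  shows "v / (- \<beta>) ^ n \<in> open_ivl \<beta> \<and> (neg_beta_T \<beta> ^^ n) (v / (- \<beta>) ^ n) = v"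
proof (induction n)
  case 0
  then show ?case using assms by simp
next
  case (Suc n)
  have *: "v / (- \<beta>) ^ Suc n = (v / (- \<beta>) ^ n) / - \<beta>"
    by simp
  show ?case
    unfolding * funpow_Suc_right o_apply
    using Suc open_ivl_div[OF assms(1)] neg_beta_T_div[OF assms(1)] by metis
qed

lemma ex_scaling_into_open_ivl:
  assumes "\<beta> > 1"
  shows "\<exists>n\<^sub>0. \<forall>n\<ge>n\<^sub>0. u / (- \<beta>) ^ n \<in> open_ivl \<beta>"
proof -
  have "(\<lambda>n. u * (1 / - \<beta>) ^ n) \<longlonglongrightarrow> u * 0"
    by (intro tendsto_mult tendsto_const LIMSEQ_power_zero) (use assms in auto)
  moreover have "u * (1 / - \<beta>) ^ n = u / (- \<beta>) ^ n" for n
    by (subst power_divide) simp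
  ultimately have "(\<lambda>n. u / (- \<beta>) ^ n) \<longlonglongrightarrow> 0"
    by simp
  then have "\<forall>\<^sub>F n in sequentially. u / (- \<beta>) ^ n \<in> open_ivl \<beta>"
    by (rule topological_tendstoD) (use ell_bounds[OF assms] in auto)
  then show ?thesis by (simp add: eventually_sequentially)
qed

text \<open>The number behind the point. Every \<open>n\<close> that scales \<open>u\<close> into
  the open interval gives the same value, so two summands and their sum can share one
  \<open>n\<close> in place of three minimal shifts.\<close>

definition frac_state :: "real \<Rightarrow> nat \<Rightarrow> real \<Rightarrow> real" where
  "frac_state \<beta> n u = (neg_beta_T \<beta> ^^ n) (u / (- \<beta>) ^ n)"

lemma frac_state_range:
  "u / (- \<beta>) ^ n \<in> open_ivl \<beta> \<Longrightarrow> frac_state \<beta> n u \<in> unit_ivl \<beta>"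
  unfolding frac_state_def by (rule neg_beta_T_pow_range) auto

text \<open>Beyond the minimal shift, each further division by -\<beta> only puts a digit 0 in
  front, which \<open>neg_beta_T\<close> removes again.\<close>

lemma neg_beta_frac_digit_eq:
  assumes "\<beta> > 1" "u / (- \<beta>) ^ n \<in> open_ivl \<beta>"
  shows "neg_beta_frac_digit \<beta> u (Suc i) =
    \<lfloor>- \<beta> * (neg_beta_T \<beta> ^^ i) (frac_state \<beta> n u) - ell \<beta>\<rfloor>"
proof -
  define k where "k = neg_beta_shift \<beta> u"
  have k: "u / (- \<beta>) ^ k \<in> open_ivl \<beta>" and "k \<le> n"
    using assms(2) unfolding k_def neg_beta_shift_def by (rule LeastI, rule Least_le)
  have n: "n = k + (n - k)" using \<open>k \<le> n\<close> by simp
  have n': "u / (- \<beta>) ^ n = (u / (- \<beta>) ^ k) / (- \<beta>) ^ (n - k)"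
    unfolding divide_divide_eq_left power_add[symmetric] n[symmetric] by (rule refl)
  have "frac_state \<beta> n u =
      (neg_beta_T \<beta> ^^ k) ((neg_beta_T \<beta> ^^ (n - k)) ((u / (- \<beta>) ^ k) / (- \<beta>) ^ (n - k)))"
    unfolding frac_state_def o_apply[symmetric, of "neg_beta_T \<beta> ^^ k"] funpow_add[symmetric]
      n[symmetric] n'[symmetric] by (rule refl)
  also have "\<dots> = (neg_beta_T \<beta> ^^ k) (u / (- \<beta>) ^ k)"
    using neg_beta_T_pow_div[OF assms(1) k] by simp
  finally have *: "frac_state \<beta> n u = (neg_beta_T \<beta> ^^ k) (u / (- \<beta>) ^ k)" .
  have "(neg_beta_T \<beta> ^^ (k + Suc i - 1)) (u / (- \<beta>) ^ k) =
      (neg_beta_T \<beta> ^^ i) (frac_state \<beta> n u)"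
    unfolding * by (metis add.commute add_Suc_right diff_Suc_1 funpow_add o_apply)
  then show ?thesis
    unfolding neg_beta_frac_digit_def neg_beta_digit_def k_def[symmetric] Let_def by simp
qed

lemma neg_beta_T_zero_digit:
  "\<lfloor>- \<beta> * x - ell \<beta>\<rfloor> = 0 \<Longrightarrow> neg_beta_T \<beta> x = - \<beta> * x"
  by (simp add: neg_beta_T_def)

text \<open>A vanishing digit multiplies the state by \<open>-\<beta>\<close>, so an orbit all of whose digits
  vanish would leave the interval unless it starts at 0.\<close>

lemma neg_beta_integers_iff:
  assumes "\<beta> > 1" "u / (- \<beta>) ^ n \<in> open_ivl \<beta>"
  shows "u \<in> neg_beta_integers \<beta> \<longleftrightarrow> frac_state \<beta> n u = 0"
proof
  define s where "s = frac_state \<beta> n u"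
  assume "u \<in> neg_beta_integers \<beta>"
  then have d: "\<lfloor>- \<beta> * (neg_beta_T \<beta> ^^ i) s - ell \<beta>\<rfloor> = 0" for i
    using neg_beta_frac_digit_eq[OF assms, of i] unfolding neg_beta_integers_def s_def by auto
  have pow: "(neg_beta_T \<beta> ^^ i) s = (- \<beta>) ^ i * s" for i
  proof (induction i)
    case (Suc i)
    then show ?case using neg_beta_T_zero_digit[OF d[of i]] by simp
  qed simp
  have "\<bar>s\<bar> * \<beta> ^ i \<le> 1" for i
  proof -
    have "(neg_beta_T \<beta> ^^ i) s \<in> unit_ivl \<beta>"
      by (intro neg_beta_T_pow_range) (use frac_state_range[OF assms(2)] s_def in simp)
    then have "\<bar>(- \<beta>) ^ i * s\<bar> \<le> 1"
      unfolding pow using ell_bounds[OF assms(1)] by auto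
    then show ?thesis using assms(1) by (simp add: abs_mult power_abs mult.commute)
  qed
  then have bd: "\<beta> ^ i \<le> 1 / \<bar>s\<bar>" if "s \<noteq> 0" for i
    using that by (simp add: field_simps)
  obtain i where "1 / \<bar>s\<bar> < \<beta> ^ i" using real_arch_pow[OF assms(1)] by blast
  then show "s = 0" using bd[of i] by force
next
  assume "frac_state \<beta> n u = 0"
  then have "neg_beta_frac_digit \<beta> u (Suc i) = 0" for i
    using neg_beta_frac_digit_eq[OF assms] neg_beta_T_pow_0[OF assms(1)] ell_bounds[OF assms(1)]
    by (simp add: floor_unique)
  then show "u \<in> neg_beta_integers \<beta>"
    unfolding neg_beta_integers_def by (auto simp: Suc_le_eq gr0_conv_Suc)
qed

lemma neg_beta_frac_digit_eq_0:
  assumes "\<beta> > 1" "u / (- \<beta>) ^ n \<in> open_ivl \<beta>"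
    "(neg_beta_T \<beta> ^^ N) (frac_state \<beta> n u) = 0" "i > N"
  shows "neg_beta_frac_digit \<beta> u i = 0"
proof -
  obtain j where j: "i = Suc j" "j \<ge> N" using assms(4) by (cases i) auto
  show ?thesis
    unfolding j neg_beta_frac_digit_eq[OF assms(1,2)]
      neg_beta_T_pow_eq_0_mono[OF assms(1,3) j(2)]
    using ell_bounds[OF assms(1)] by (simp add: floor_unique)
qed

section \<open>The length of the fractional part as a hitting time of 0\<close>

lemma fr_eqI:
  assumes "n \<ge> 1" "neg_beta_frac_digit \<beta> u n \<noteq> 0" "\<And>i. i > n \<Longrightarrow> neg_beta_frac_digit \<beta> u i = 0"
  shows "fr \<beta> u = n"
proof -
  have "u \<notin> neg_beta_integers \<beta>"
    using assms(1,2) unfolding neg_beta_integers_def by auto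
  moreover have "(THE n. n \<ge> 1 \<and> neg_beta_frac_digit \<beta> u n \<noteq> 0 \<and>
      (\<forall>i>n. neg_beta_frac_digit \<beta> u i = 0)) = n"
  proof (intro the_equality)
    fix k assume "k \<ge> 1 \<and> neg_beta_frac_digit \<beta> u k \<noteq> 0 \<and>
      (\<forall>i>k. neg_beta_frac_digit \<beta> u i = 0)"
    then show "k = n" using assms by (metis linorder_neqE_nat)
  qed (use assms in auto)
  ultimately show ?thesis unfolding fr_def by simp
qed

text \<open>A digit 0 at place \<open>Suc N\<close> would multiply the nonzero state by -\<beta> and
  could not lead to 0.\<close>

lemma fr_eq_Suc:
  assumes "\<beta> > 1" "u / (- \<beta>) ^ n \<in> open_ivl \<beta>"
    "(neg_beta_T \<beta> ^^ Suc N) (frac_state \<beta> n u) = 0"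
    "(neg_beta_T \<beta> ^^ N) (frac_state \<beta> n u) \<noteq> 0"
  shows "fr \<beta> u = Suc N"
proof (rule fr_eqI)
  show "neg_beta_frac_digit \<beta> u (Suc N) \<noteq> 0"
    using assms(1,3,4) neg_beta_T_zero_digit[of \<beta> "(neg_beta_T \<beta> ^^ N) (frac_state \<beta> n u)"]
    unfolding neg_beta_frac_digit_eq[OF assms(1,2)] by auto
qed (use neg_beta_frac_digit_eq_0[OF assms(1-3)] in auto)

lemma finite_expansion_fr_le:
  assumes "\<beta> > 1" "u / (- \<beta>) ^ n \<in> open_ivl \<beta>"
    "(neg_beta_T \<beta> ^^ N) (frac_state \<beta> n u) = 0"
  shows "finite_neg_beta_expansion \<beta> u \<and> fr \<beta> u \<le> N"
proof
  show "finite_neg_beta_expansion \<beta> u"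
    using neg_beta_frac_digit_eq_0[OF assms] unfolding finite_neg_beta_expansion_def by blast
  \<comment> \<open>The first time at which the orbit is 0 is the exact value of
    \<open>fr\<close>.\<close>
  define M where "M = (LEAST k. (neg_beta_T \<beta> ^^ k) (frac_state \<beta> n u) = 0)"
  have M: "(neg_beta_T \<beta> ^^ M) (frac_state \<beta> n u) = 0" "M \<le> N"
    using assms(3) unfolding M_def by (rule LeastI, rule Least_le)
  show "fr \<beta> u \<le> N"
  proof (cases M)
    case 0
    then have "u \<in> neg_beta_integers \<beta>" using M neg_beta_integers_iff[OF assms(1,2)] by simp
    then show ?thesis by (simp add: fr_def)
  next
    case (Suc k)
    then have "(neg_beta_T \<beta> ^^ k) (frac_state \<beta> n u) \<noteq> 0"
      using not_less_Least[of k "\<lambda>k. (neg_beta_T \<beta> ^^ k) (frac_state \<beta> n u) = 0"] M_def by simp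
    then show ?thesis using fr_eq_Suc[OF assms(1,2), of k] M Suc by simp
  qed
qed

section \<open>Integer windows\<close>

text \<open>The value of \<open>a - b + c\<close> for which \<open>lin a b c\<close> lies in \<open>[\<ell>, \<ell> + 1)\<close>, when \<open>M = m\<close>.\<close>

definition correction :: "int \<Rightarrow> int \<Rightarrow> int \<Rightarrow> int" where
  "correction M a b =
     (if a = M + 1 then 1 else if a \<ge> 0 \<or> (a = -1 \<and> b \<le> -1) then 0 else -1)"

text \<open>Column by column, these are the points with \<open>max {\<bar>a\<bar>, \<bar>b\<bar>,
  \<bar>a - b\<bar>} \<le> M + 1\<close>, without the six vertices and without the side
  \<open>a - b = M + 1\<close>.\<close>

definition hexagon :: "int \<Rightarrow> (int \<times> int) set" where
  "hexagon M = {(a, b).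
     (a = - M - 1 \<and> - M \<le> b \<and> b \<le> -1) \<or>
     (- M \<le> a \<and> a \<le> -1 \<and> - M - 1 \<le> b \<and> b \<le> a + M + 1) \<or>
     (a = 0 \<and> - M \<le> b \<and> b \<le> M) \<or>
     (1 \<le> a \<and> a \<le> M \<and> a - M \<le> b \<and> b \<le> M + 1) \<or>
     (a = M + 1 \<and> 1 \<le> b \<and> b \<le> M)}"

text \<open>A slightly larger region on which the rule for \<open>correction\<close> is still valid; it contains all
  \<open>(a, b)\<close> that occur before one knows that \<open>lin a b c\<close> lies in \<open>[\<ell>, \<ell> + 1)\<close>.\<close>

definition wide_hexagon :: "int \<Rightarrow> (int \<times> int) set" where
  "wide_hexagon M = {(a, b). - M - 1 \<le> a \<and> a \<le> M + 1 \<and> - M - 1 \<le> b \<and> b \<le> M + 1 \<and>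
     (a = M + 1 \<longrightarrow> 0 \<le> b \<and> b \<le> M) \<and> (a = - M - 1 \<longrightarrow> b \<le> 0) \<and>
     (1 \<le> a \<longrightarrow> a - M - 1 \<le> b) \<and> (a \<le> -2 \<longrightarrow> b \<le> a + M + 1)}"

text \<open>The windows of \<open>T\<^sup>n x - T\<^sup>n y - T\<^sup>n z\<close>; here \<open>lin a b c\<close> ranges over an interval of length 3.\<close>

definition sum_region :: "int \<Rightarrow> (int \<times> int \<times> int) set" where
  "sum_region M = {(a, b, c).
     - M \<le> a \<and> a \<le> M + 1 \<and> - M \<le> b \<and> b \<le> M + 1 \<and>
     (a - b + c = -1 \<and> - M \<le> c \<and> c \<le> M \<and> (a \<le> 0 \<or> a = 1 \<and> b \<ge> 1) \<or>
      a - b + c = 0 \<and> - M \<le> c \<and> c \<le> M \<and> (a \<le> M \<or> 1 \<le> b \<and> b \<le> M) \<or>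
      a - b + c = 1 \<and> - M \<le> c \<and> c \<le> (if a \<le> 0 then M + 1 else M) \<and>
        (a \<le> M \<or> 1 \<le> b \<and> b \<le> M) \<or>
      a - b + c = 2 \<and> 1 - M \<le> c \<and> c \<le> M \<and> (a \<ge> 2 \<or> a = 1 \<and> b \<le> 0) \<and>
        (a \<le> M \<or> b \<le> M \<and> (b \<ge> 1 \<or> M = 1)))}"

text \<open>The bounds on \<open>e\<close> say that it is \<open>- M * (a - b + c)\<close> minus a
  combination \<open>i - j - k\<close> of digits in \<open>{0..M}\<close>. The last three hypotheses
  are what the real bounds yield through \<open>lin_wide_window\<close>.\<close>

lemma sum_region_step:
  assumes "M \<ge> 1" "(a, b, c) \<in> sum_region M"
    and "- M * (a - b + c) - M \<le> e" "e \<le> - M * (a - b + c) + 2 * M"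
    and "b - c + e \<in> {-1..2}"
    and "b - c + e = -1 \<Longrightarrow> b \<le> 0 \<or> b = 1 \<and> c \<ge> 1"
    and "b - c + e = 2 \<Longrightarrow> b \<ge> 2 \<or> b = 1 \<and> c \<le> 0"
  shows "(b, c, e) \<in> sum_region M"
proof -
  have r: "- M \<le> a" "a \<le> M + 1" "- M \<le> b" "b \<le> M + 1" "- M \<le> c" "c \<le> M + 1"
    using assms(2) unfolding sum_region_def by (auto split: if_splits)
  have t: "a - b + c = -1 \<or> a - b + c = 0 \<or> a - b + c = 1 \<or> a - b + c = 2"
    using assms(2) unfolding sum_region_def by auto
  have u: "b - c + e = -1 \<or> b - c + e = 0 \<or> b - c + e = 1 \<or> b - c + e = 2"
    using assms(5) by auto
  have v: "b \<le> 0 \<or> b = 1 \<and> c \<ge> 1 \<or> b - c + e \<noteq> -1" "b \<ge> 2 \<or> b = 1 \<and> c \<le> 0 \<or> b - c + e \<noteq> 2"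
    using assms(6,7) by auto
  show ?thesis
    using t
  proof (elim disjE)
    assume "a - b + c = -1"
    moreover from this have "0 \<le> e" "c \<le> M" "a \<le> 0 \<or> a = 1 \<and> b \<ge> 1"
      using assms(2,3) unfolding sum_region_def by auto
    ultimately show ?thesis
      using assms(1) r u v unfolding sum_region_def mem_Collect_eq prod.case
      by smt
  next
    assume "a - b + c = 0"
    moreover from this have "- M \<le> e" "e \<le> 2 * M" "c \<le> M" "a \<le> M \<or> 1 \<le> b \<and> b \<le> M"
      using assms(2,3,4) unfolding sum_region_def by auto
    ultimately show ?thesis
      using assms(1) r u v unfolding sum_region_def mem_Collect_eq prod.case
      by smt
  next
    assume "a - b + c = 1"
    moreover from this have "e \<le> M" "- 2 * M \<le> e" "c \<le> (if a \<le> 0 then M + 1 else M)" 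
        "a \<le> M \<or> 1 \<le> b \<and> b \<le> M"
      using assms(2,3,4) unfolding sum_region_def by auto
    ultimately show ?thesis
      using assms(1) r u v unfolding sum_region_def mem_Collect_eq prod.case
      by smt
  next
    assume "a - b + c = 2"
    moreover from this have "e \<le> 0" "1 - M \<le> c" "c \<le> M" "a \<ge> 2 \<or> a = 1 \<and> b \<le> 0"
        "a \<le> M \<or> b \<le> M \<and> (b \<ge> 1 \<or> M = 1)"
      using assms(2,3,4) unfolding sum_region_def by auto
    ultimately show ?thesis
      using assms(1) r u v unfolding sum_region_def mem_Collect_eq prod.case
      by smt
  qed
qed

lemma hexagon_step:
  assumes "M \<ge> 1" "(a, b) \<in> hexagon M"
  shows "(b, correction M a b - a + b) \<in> hexagon M"
  using assms unfolding hexagon_def correction_def mem_Collect_eq prod.case by smt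

lemma sum_region_hexagon:
  assumes "M \<ge> 1" "(a, b, c) \<in> sum_region M" "a - b + c = correction M a b"
  shows "(a, b) \<in> hexagon M"
  using assms unfolding hexagon_def sum_region_def correction_def mem_Collect_eq prod.case by smt

lemma neg_sum_region_hexagon:
  assumes "M \<ge> 1" "(- a, - b, - c) \<in> sum_region M" "a - b + c = correction M a b"
  shows "(a, b) \<in> hexagon M"
  using assms unfolding hexagon_def sum_region_def correction_def mem_Collect_eq prod.case by smt

lemma hexagon_subset: "M \<ge> 1 \<Longrightarrow> hexagon M \<subseteq> wide_hexagon M"
  by (auto simp: hexagon_def wide_hexagon_def)

lemma sum_region_wide_hexagon:
  "M \<ge> 1 \<Longrightarrow> (a, b, c) \<in> sum_region M \<Longrightarrow> (a, b) \<in> wide_hexagon M"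
  unfolding sum_region_def wide_hexagon_def mem_Collect_eq prod.case by smt

lemma neg_sum_region_wide_hexagon:
  "M \<ge> 1 \<Longrightarrow> (- a, - b, - c) \<in> sum_region M \<Longrightarrow> (a, b) \<in> wide_hexagon M"
  unfolding sum_region_def wide_hexagon_def mem_Collect_eq prod.case by smt

text \<open>The leading term is three times the size of the pair in the hexagonal norm
  \<open>max {\<bar>a\<bar>, \<bar>b\<bar>, \<bar>a - b\<bar>}\<close>; the six branches are the sectors of the rotation.\<close>

definition potential :: "int \<Rightarrow> int \<Rightarrow> int" where
  "potential a b =
     (if a \<ge> 0 \<and> b > a then 3 * b + (if odd b then 3 else 1)
      else if a > 0 \<and> b > 0 then 3 * a + (if odd a then 2 else 0)
      else if a > 0 then 3 * (a - b) + (if odd (a - b) then 1 else -1)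
      else if b < 0 \<and> b < a then - 3 * b + (if odd b then 0 else -2)
      else if b < 0 then - 3 * a + (if odd a then -1 else -3) - (if b = -1 \<and> a \<le> -2 then 1 else 0)
      else if a < 0 then 3 * (b - a) + (if odd (b - a) then -1 else 1) - (if a = -1 then 1 else 0)
      else 0)"

lemma potential_pos:
  assumes "(a, b) \<noteq> (0, 0)"
  shows "potential a b > 0"
  using assms unfolding potential_def by (auto; presburger)

text \<open>\<open>t\<close> is the correction away from the corner \<open>a = M + 1\<close>.\<close>

lemma potential_step:
  assumes "(a, b) \<noteq> (0, 0)" and t: "t = (if a \<ge> 0 \<or> (a = -1 \<and> b \<le> -1) then 0 else -1)"
  shows "potential b (t - a + b) < potential a b"
proof (cases "even a"; cases "even b")
  assume "even a" "even b"
  then show ?thesis using assms(1) by (auto simp: potential_def t)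
next
  assume "even a" "odd b"
  then show ?thesis using assms(1) by (auto simp: potential_def t; presburger)
next
  assume "odd a" "even b"
  then show ?thesis using assms(1) by (auto simp: potential_def t)
next
  assume "odd a" "odd b"
  then show ?thesis using assms(1) by (auto simp: potential_def t)
qed

section \<open>Iterating the map of integer pairs\<close>

definition shift_map :: "int \<Rightarrow> int \<times> int \<Rightarrow> int \<times> int" where
  "shift_map M = (\<lambda>(a, b). (b, correction M a b - a + b))"

lemma shift_map_0 [simp]: "M \<ge> 0 \<Longrightarrow> (shift_map M ^^ n) (0, 0) = (0, 0)"
  by (induction n) (auto simp: shift_map_def correction_def)

text \<open>The potential is known to drop only where the first entry is not \<open>M + 1\<close>,
  so the bound \<open>M\<close> on both entries is carried along the orbit.\<close>

lemma shift_map_pow_potential: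
  assumes "M \<ge> 1" "(a, b) \<in> hexagon M" "a \<le> M" "b \<le> M"
  shows "potential a b \<le> int n \<Longrightarrow> (shift_map M ^^ n) (a, b) = (0, 0)"
  using assms(2-)
proof (induction n arbitrary: a b)
  case 0
  then show ?case using potential_pos[of a b] by force
next
  case (Suc n)
  let ?c = "correction M a b - a + b"
  show ?case
  proof (cases "(a, b) = (0, 0)")
    case False
    have "potential b ?c < potential a b"
      using Suc.prems(3) False by (intro potential_step) (auto simp: correction_def)
    moreover have "?c \<le> M"
      using Suc.prems(2-4) assms(1) unfolding hexagon_def correction_def mem_Collect_eq prod.case by smt
    ultimately have "(shift_map M ^^ n) (b, ?c) = (0, 0)"
      using Suc.prems hexagon_step[OF assms(1)] by (intro Suc.IH) auto
    then show ?thesis by (simp add: funpow_Suc_right shift_map_def del: funpow.simps)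
  qed (use assms(1) in \<open>simp del: funpow.simps\<close>)
qed

text \<open>For odd \<open>M \<ge> 3\<close> the value \<open>3 * M + 4\<close> occurs on the side
  \<open>b - a = M + 1\<close> with \<open>a \<le> -2\<close>. For \<open>M = 1\<close> only
  \<open>a = -1\<close> is left on that side, where the potential is smaller by 1.\<close>

lemma potential_le:
  assumes "M \<ge> 1" "(a, b) \<in> hexagon M" "a \<le> M" "b \<le> M"
  shows "potential a b \<le> 3 * M + (if M = 1 \<or> even M then 3 else 4)"
proof -
  obtain p q r where "a = 2 * p \<or> a = 2 * p + 1" "b = 2 * q \<or> b = 2 * q + 1"
    "M = 2 * r \<or> M = 2 * r + 1"
    by (metis evenE oddE)
  then show ?thesis
    using assms unfolding hexagon_def potential_def mem_Collect_eq prod.case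
    by (elim disjE; simp; smt)
qed

text \<open>Pairs with an entry \<open>M + 1\<close> escape the potential argument. They are
  followed explicitly for one or two steps, after which both entries are at most \<open>M\<close>
  and the potential is small enough to make up for these steps.\<close>

lemma shift_map_pow_eq_0:
  assumes "M \<ge> 1" "(a, b) \<in> hexagon M"
    and n: "int n = 3 * M + (if M = 1 \<or> even M then 3 else 4)"
  shows "(shift_map M ^^ n) (a, b) = (0, 0)"
proof -
  have n3: "3 * M + 3 \<le> int n" using n by simp
  consider "a \<le> M" "b \<le> M" | "a = M + 1" "1 \<le> b" "b \<le> M" | "b = M + 1" "1 \<le> a" "a \<le> M"
    using assms(1,2) unfolding hexagon_def mem_Collect_eq prod.case by smt
  then show ?thesis
  proof cases
    case 1
    then show ?thesis using potential_le[OF assms(1,2)] shift_map_pow_potential[OF assms(1,2)] n by simp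
  next
    case 2
    have "potential b (b - M) \<le> 3 * M + 2" "(b, b - M) \<in> hexagon M"
      using 2 by (auto simp: potential_def hexagon_def)
    then have "(shift_map M ^^ (n - 1)) (b, b - M) = (0, 0)"
      using 2 assms(1) n3 by (intro shift_map_pow_potential) auto
    moreover have "shift_map M (a, b) = (b, b - M)"
      using 2 by (simp add: shift_map_def correction_def)
    moreover have "n = Suc (n - 1)" using n3 assms(1) by simp
    ultimately show ?thesis by (metis funpow_Suc_right o_apply)
  next
    case 3
    have "potential (M + 1 - a) (1 - a) \<le> 3 * M + 1" "(M + 1 - a, 1 - a) \<in> hexagon M"
      using 3 assms(1) by (auto simp: potential_def hexagon_def)
    then have "(shift_map M ^^ (n - 2)) (M + 1 - a, 1 - a) = (0, 0)"
      using 3 assms(1) n3 by (intro shift_map_pow_potential) auto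
    moreover have "shift_map M (shift_map M (a, b)) = (M + 1 - a, 1 - a)"
      using 3 assms(1) by (simp add: shift_map_def correction_def)
    moreover have "n = Suc (Suc (n - 2))" using n3 assms(1) by simp
    ultimately show ?thesis by (metis funpow_Suc_right o_apply)
  qed
qed

text \<open>Six steps lower both entries by 2. The exact time at which \<open>(-1, 0)\<close>, the
  predecessor of \<open>(0, 0)\<close>, is reached serves the lower bound for even
  \<open>m\<close>.\<close>

lemma shift_map_pow_diagonal:
  assumes "2 * int j + 1 \<le> M"
  shows "(shift_map M ^^ (6 * j + 4)) (2 * int j + 1, 2 * int j + 1) = (-1, 0)"
  using assms
proof (induction j)
  case 0
  then show ?case by (simp add: eval_nat_numeral shift_map_def correction_def)
next
  case (Suc j)
  define k where "k = 2 * int j + 1"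
  have "(shift_map M ^^ 6) (k + 2, k + 2) = (k, k)"
    using Suc.prems by (simp add: eval_nat_numeral shift_map_def correction_def k_def)
  moreover have "(shift_map M ^^ (6 * j + 4)) (k, k) = (-1, 0)"
    using Suc unfolding k_def by simp
  moreover have "6 * Suc j + 4 = (6 * j + 4) + 6" "2 * int (Suc j) + 1 = k + 2"
    by (simp_all add: k_def)
  ultimately show ?case by (metis funpow_add o_apply)
qed

text \<open>Again six steps lower the size by 2; this orbit serves the lower bound for odd
  \<open>m \<ge> 3\<close>.\<close>

lemma shift_map_pow_minus_two:
  assumes "2 * int j + 1 \<le> M"
  shows "(shift_map M ^^ (6 * j + 6)) (-2, 2 * int j) = (-1, 0)"
  using assms
proof (induction j)
  case 0
  then show ?case by (simp add: eval_nat_numeral shift_map_def correction_def)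
next
  case (Suc j)
  define k where "k = 2 * int j"
  have "(shift_map M ^^ 6) (-2, k + 2) = (-2, k)"
    using Suc.prems by (simp add: eval_nat_numeral shift_map_def correction_def k_def)
  moreover have "(shift_map M ^^ (6 * j + 6)) (-2, k) = (-1, 0)"
    using Suc unfolding k_def by simp
  moreover have "6 * Suc j + 6 = (6 * j + 6) + 6" "2 * int (Suc j) = k + 2"
    by (simp_all add: k_def)
  ultimately show ?case by (metis funpow_add o_apply)
qed

section \<open>The cubic base\<close>

locale cubic_base =
  fixes \<beta> :: real and m :: nat
  assumes m_pos: "m \<ge> 1" and beta_gt_1: "\<beta> > 1"
    and cubic: "\<beta> ^ 3 - real m * \<beta> ^ 2 - real m * \<beta> - real m = 0"
begin

text \<open>\<open>q\<close> turns out to be the fractional part of \<beta>, \<open>h\<close> is the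
  distance from 0 to the left end of the interval, and \<open>p\<close> is chosen so that
  \<open>1 - q = p / \<beta>\<close>.\<close>

definition p :: real where "p = m / \<beta>\<^sup>2"
definition q :: real where "q = \<beta> - m"
definition h :: real where "h = \<beta> / (\<beta> + 1)"

lemma ell_eq: "ell \<beta> = - h"
  by (simp add: ell_def h_def)

lemma cube: "\<beta> ^ 3 = m * (\<beta>\<^sup>2 + \<beta> + 1)"
  using cubic by (simp add: algebra_simps)

lemma m_ge_1: "real m \<ge> 1"
  using m_pos by simp

lemma q_eq: "q = p * (\<beta> + 1)"
proof -
  have "\<beta>\<^sup>2 * q = m * (\<beta> + 1)"
    using cube by (simp add: q_def power2_eq_square power3_eq_cube algebra_simps)
  then show ?thesis using beta_gt_1 by (simp add: p_def field_simps)
qed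

lemma one_minus_q: "1 - q = p / \<beta>"
proof -
  have "\<beta> ^ 3 * (1 - q) =
      \<beta> ^ 3 - m * \<beta>\<^sup>2 - m * \<beta> + \<beta> * (m * (\<beta>\<^sup>2 + \<beta> + 1) - \<beta> ^ 3)"
    by (simp add: q_def power2_eq_square power3_eq_cube algebra_simps)
  then have "\<beta> ^ 3 * (1 - q) = m"
    using cubic cube by simp
  then have "1 - q = m / \<beta> ^ 3"
    using beta_gt_1 by (simp add: field_simps)
  also have "\<dots> = p / \<beta>"
    by (simp add: p_def power2_eq_square power3_eq_cube)
  finally show ?thesis .
qed

lemma p_pos: "p > 0"
  using m_pos beta_gt_1 by (simp add: p_def)

lemma q_less_1: "q < 1"
  using one_minus_q p_pos beta_gt_1 by (metis diff_gt_0_iff_gt divide_pos_pos less_trans zero_less_one)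

lemma square_gt: "\<beta> + 1 < \<beta>\<^sup>2"
proof (rule ccontr)
  assume "\<not> \<beta> + 1 < \<beta>\<^sup>2"
  then have "\<beta> * \<beta>\<^sup>2 \<le> \<beta> * (\<beta> + 1)"
    using beta_gt_1 by (intro mult_left_mono) auto
  moreover have "1 * (\<beta>\<^sup>2 + \<beta> + 1) \<le> \<beta> * \<beta>\<^sup>2"
    using cube m_ge_1 beta_gt_1 mult_right_mono[of 1 "real m" "\<beta>\<^sup>2 + \<beta> + 1"]
    by (simp add: power3_eq_cube power2_eq_square add_nonneg_nonneg)
  ultimately show False by (simp add: power2_eq_square algebra_simps)
qed

lemma m_mult_less: "m * (\<beta> + 1) < \<beta>\<^sup>2"
proof -
  have "\<beta> * (m * (\<beta> + 1)) < \<beta> ^ 3"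
    using cube m_pos by (simp add: power2_eq_square algebra_simps)
  also have "\<beta> ^ 3 = \<beta> * \<beta>\<^sup>2"
    by (simp add: power2_eq_square power3_eq_cube)
  finally show ?thesis using beta_gt_1 by (subst (asm) mult_less_cancel_left_pos) auto
qed

lemma h_bounds: "1 / 2 < h" "h < 1" "\<beta> * h = \<beta> - h"
  using beta_gt_1 by (auto simp: h_def field_simps)

lemma h_less_q: "h < q"
proof -
  have "m * (\<beta> + 1) < \<beta> ^ 3"
    using cube m_pos beta_gt_1 by simp
  then have "p / \<beta> < 1 / (\<beta> + 1)"
    using beta_gt_1 by (simp add: p_def field_simps power2_eq_square power3_eq_cube)
  also have "1 / (\<beta> + 1) = 1 - h"
    using beta_gt_1 by (simp add: h_def field_simps)
  finally show ?thesis using one_minus_q by simp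
qed

lemma q_minus_p: "0 < q - p" "q - p < h"
proof -
  have *: "q - p = p * \<beta>" by (simp add: q_eq algebra_simps)
  then show "0 < q - p" using p_pos beta_gt_1 by simp
  have "p < 1 / (\<beta> + 1)"
    using q_less_1 beta_gt_1 unfolding q_eq by (simp add: field_simps)
  then have "p * \<beta> < 1 / (\<beta> + 1) * \<beta>"
    using beta_gt_1 by (intro mult_strict_right_mono) auto
  then show "q - p < h" unfolding * by (simp add: h_def)
qed

lemma Suc_m_p_less: "(m + 1) * p < h"
proof -
  have "m * ((m + 1) * (\<beta> + 1)) < m * (\<beta>\<^sup>2 + \<beta> + 1)"
    using m_mult_less m_pos by (intro mult_strict_left_mono) (auto simp: algebra_simps)
  then have "(m + 1) * m * (\<beta> + 1) < \<beta> ^ 3"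
    unfolding cube by (simp add: algebra_simps)
  then show ?thesis
    using beta_gt_1 by (simp add: p_def h_def field_simps power2_eq_square power3_eq_cube)
qed

text \<open>Since \<open>p = (1 - q) * \<beta>\<close>, the left side equals
  \<open>\<beta> - q * q\<close>, so the claim amounts to \<open>h \<le> q * q\<close>.\<close>

lemma m_q_plus_p_le: "m * q + p \<le> \<beta> - h"
proof -
  have "(1 + q) * (\<beta> + 1) \<le> 2 * (\<beta> + 1)"
    using q_less_1 beta_gt_1 by (intro mult_right_mono) auto
  then have "m * ((1 + q) * (\<beta> + 1)) \<le> m * (\<beta>\<^sup>2 + \<beta> + 1)"
    using square_gt by (intro mult_left_mono) auto
  then have "m * ((1 + q) * (\<beta> + 1)) \<le> \<beta> ^ 3"
    by (simp only: cube)
  then have "p * (1 + q) / \<beta> \<le> 1 / (\<beta> + 1)"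
    using beta_gt_1 by (simp add: p_def field_simps power2_eq_square power3_eq_cube)
  also have "1 / (\<beta> + 1) = 1 - h"
    using beta_gt_1 by (simp add: h_def field_simps)
  also have "p * (1 + q) / \<beta> = (1 - q) * (1 + q)"
    by (simp add: one_minus_q)
  finally have "(1 - q) * (1 + q) \<le> 1 - h" .
  moreover have "p = (1 - q) * (m + q)"
    using beta_gt_1 by (simp add: one_minus_q) (simp add: q_def)
  ultimately show ?thesis by (simp add: q_def algebra_simps)
qed

text \<open>The left side equals \<open>\<beta> - m * q / \<beta>\<close>. This inequality is what
  makes the correction 1, not 0, when the first entry is \<open>m + 1\<close>.\<close>

lemma top_bound: "(m + 1) * q - m * p > \<beta> - h"
proof -
  have "m * (\<beta> + 1) * q < \<beta>\<^sup>2 * 1"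
    using m_mult_less q_less_1 q_eq p_pos beta_gt_1 by (intro mult_strict_mono) auto
  then have "m * q / \<beta> < h"
    using beta_gt_1 by (simp add: h_def field_simps power2_eq_square)
  moreover have "m * q / \<beta> = m * p + m * (1 - q)"
    unfolding one_minus_q unfolding q_eq using beta_gt_1 by (simp add: field_simps)
  ultimately show ?thesis by (simp add: q_def algebra_simps)
qed

section \<open>Windows as linear forms and their position in the interval\<close>

definition lin :: "int \<Rightarrow> int \<Rightarrow> int \<Rightarrow> real" where
  "lin a b c = m / \<beta> * a - q * b + c"

lemma lin_0 [simp]: "lin 0 0 0 = 0"
  by (simp add: lin_def)

lemma lin_uminus: "lin (- a) (- b) (- c) = - lin a b c"
  by (simp add: lin_def)

text \<open>The cubic gives \<open>\<beta> * q = m + m / \<beta>\<close>, so multiplication by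
  -\<beta> shifts the coefficients up to an integer. The entry \<open>e\<close> is free and can
  absorb any choice of digit.\<close>

lemma neg_beta_lin: "- \<beta> * lin a b c = of_int (- int m * (a - b + c) - e) + lin b c e"
proof -
  have "\<beta> * q = m + m / \<beta>"
  proof -
    have "\<beta> * (\<beta> * q) = \<beta> * m + m"
      using cube beta_gt_1 by (simp add: q_eq p_def power2_eq_square field_simps)
    then show ?thesis using beta_gt_1 by (simp add: field_simps)
  qed
  moreover have "- \<beta> * lin a b c = - m * a + (\<beta> * q) * b - \<beta> * c"
    using beta_gt_1 by (simp add: lin_def algebra_simps)
  ultimately show ?thesis by (simp add: lin_def q_def algebra_simps)
qed

text \<open>This separates the integer that governs the position from a remainder; interval bounds
  on \<open>lin\<close> then compare \<open>b * q - c * p\<close> with multiples of \<beta>.\<close>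

lemma lin_eq: "lin b c e = (b - c + e) - (b * q - c * p) / \<beta>"
proof -
  have "m / \<beta> * b = b - b * (q / \<beta>)" using beta_gt_1 by (simp add: q_def field_simps)
  moreover have "(b * q - c * p) / \<beta> = b * (q / \<beta>) - c * (1 - q)"
    by (simp add: one_minus_q diff_divide_distrib)
  ultimately show ?thesis unfolding lin_def by (simp add: algebra_simps)
qed

lemma lin_less_iff: "lin b c e < x \<longleftrightarrow> \<beta> * (b - c + e) - \<beta> * x < b * q - c * p"
  unfolding lin_eq using beta_gt_1 by (simp add: field_simps)

lemma lin_greater_iff: "x < lin b c e \<longleftrightarrow> b * q - c * p < \<beta> * (b - c + e) - \<beta> * x"
  unfolding lin_eq using beta_gt_1 by (simp add: field_simps)

lemma beta_eq: "\<beta> = m + q"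
  by (simp add: q_def)

lemma q_pos: "0 < q"
  using h_less_q h_bounds by linarith

lemma int_mult_mono:
  fixes b c :: int and x :: real
  assumes "b \<le> c" "0 < x"
  shows "of_int b * x \<le> of_int c * x"
  using assms by (intro mult_right_mono) auto

text \<open>The numbers \<open>h - 2\<close> and \<open>h + 1\<close> bound \<open>x - y - z\<close>
  for three points of the interval.\<close>

lemma lin_wide_window:
  fixes b c e :: int
  assumes b: "- int m \<le> b" "b \<le> int m + 1" and c: "- int m - 1 \<le> c" "c \<le> int m + 1"
    and cb: "c - b \<le> int m + 1" "b - c \<le> int m + 1"
    and lin: "h - 2 < lin b c e" "lin b c e < h + 1"
  shows "b - c + e \<in> {-1..2}"
    and "b - c + e = -1 \<Longrightarrow> b \<le> 0 \<or> b = 1 \<and> c \<ge> 1"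
    and "b - c + e = 2 \<Longrightarrow> b \<ge> 2 \<or> b = 1 \<and> c \<le> 0"
proof -
  \<comment> \<open>Products with \<open>p\<close>, \<open>q\<close> and \<open>q - p\<close> are
    the atoms of the linear arithmetic below, so common factors have to stay.\<close>
  note [[simproc del: linordered_ring_le_cancel_factor]]
  define t where "t = b - c + e"
  define \<delta> where "\<delta> = b * q - c * p"
  note bd = p_pos q_pos q_less_1 h_bounds(1,2) h_less_q q_minus_p Suc_m_p_less m_q_plus_p_le beta_eq
  have bh: "\<beta> * (h - 2) = - \<beta> - h" "\<beta> * (h + 1) = 2 * \<beta> - h"
    using h_bounds(3) by (simp_all add: algebra_simps)
  have low: "\<beta> * (of_int t - 2) + h < \<delta>"
    using lin(2) unfolding lin_less_iff bh \<delta>_def t_def by (simp add: algebra_simps)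
  have high: "\<delta> < \<beta> * (of_int t + 1) + h"
    using lin(1) unfolding lin_greater_iff bh \<delta>_def t_def by (simp add: algebra_simps)
  have cp: "- (m + 1) * p \<le> c * p" "c * p \<le> (m + 1) * p"
    using int_mult_mono[OF c(1) p_pos] int_mult_mono[OF c(2) p_pos] by (simp_all add: algebra_simps)
  have "t \<ge> -1"
  proof (rule ccontr)
    assume "\<not> t \<ge> -1"
    then have "\<beta> * (of_int t + 1) \<le> \<beta> * -1"
      using beta_gt_1 by (intro mult_left_mono) linarith+
    then have "\<delta> < - \<beta> + h" using high by simp
    \<comment> \<open>Writing \<delta> as \<open>b * (q - p) - (c - b) * p\<close> gives the lower
      bound \<open>- m * q - p\<close>, and \<open>m_q_plus_p_le\<close> makes this at least
      \<open>h - \<beta>\<close>.\<close>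
    moreover have "of_int (- int m) * (q - p) \<le> b * (q - p)"
      using int_mult_mono[OF b(1) q_minus_p(1)] by simp
    moreover have "c * p \<le> of_int (b + int m + 1) * p"
      using cb(1) by (intro int_mult_mono p_pos) simp
    ultimately show False
      using bd unfolding \<delta>_def by (simp add: algebra_simps)
  qed
  moreover have "t \<le> 2"
  proof (rule ccontr)
    assume "\<not> t \<le> 2"
    then have "\<beta> * 1 \<le> \<beta> * (of_int t - 2)"
      using beta_gt_1 by (intro mult_left_mono) linarith+
    then have "\<beta> + h < \<delta>" using low by simp
    moreover have "b * (q - p) \<le> of_int (int m + 1) * (q - p)"
      using int_mult_mono[OF b(2) q_minus_p(1)] by simp
    moreover have "of_int (b - int m - 1) * p \<le> c * p"
      using cb(2) by (intro int_mult_mono p_pos) simp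
    moreover have "m * q \<le> m"
      using q_less_1 mult_left_mono[of q 1 "real m"] by simp
    ultimately show False
      using bd unfolding \<delta>_def by (simp add: algebra_simps)
  qed
  ultimately show "b - c + e \<in> {-1..2}" by (simp add: t_def)
  show "b \<le> 0 \<or> b = 1 \<and> c \<ge> 1" if "b - c + e = -1"
  proof (rule ccontr)
    assume neg: "\<not> ?thesis"
    have "\<delta> < h" using high that by (simp add: t_def)
    moreover have "h \<le> \<delta>"
    proof (cases "b = 1")
      case True
      then have "c * p \<le> of_int (0) * p" using neg by (intro int_mult_mono p_pos) simp
      then show ?thesis using True bd unfolding \<delta>_def by simp
    next
      case False
      then have "of_int (2) * q \<le> b * q" using neg by (intro int_mult_mono q_pos) simp
      then show ?thesis using cp bd unfolding \<delta>_def by (simp add: algebra_simps)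
    qed
    ultimately show False by simp
  qed
  show "b \<ge> 2 \<or> b = 1 \<and> c \<le> 0" if "b - c + e = 2"
  proof (rule ccontr)
    assume neg: "\<not> ?thesis"
    have "h < \<delta>" using low that by (simp add: t_def)
    moreover have "\<delta> \<le> h"
    proof (cases "b = 1")
      case True
      then have "of_int (1) * p \<le> c * p" using neg by (intro int_mult_mono p_pos) simp
      then show ?thesis using True bd unfolding \<delta>_def by simp
    next
      case False
      then have "b * q \<le> of_int (0) * q" using neg by (intro int_mult_mono q_pos) simp
      then show ?thesis using cp bd unfolding \<delta>_def by (simp add: algebra_simps)
    qed
    ultimately show False by simp
  qed
qed

text \<open>With \<open>t\<close> the correction, membership means
  \<open>\<beta> * t - h < \<delta> \<le> \<beta> * (t + 1) - h\<close>; this is checked for each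
  range of \<open>b\<close> on which \<open>t\<close> is constant.\<close>

lemma lin_correction_in_unit_ivl:
  assumes "(b, c) \<in> wide_hexagon (int m)"
  shows "lin b c (correction (int m) b c - b + c) \<in> unit_ivl \<beta>"
proof -
  note [[simproc del: linordered_ring_le_cancel_factor]]
  define t where "t = correction (int m) b c"
  define \<delta> where "\<delta> = b * q - c * p"
  note bd = p_pos q_pos q_less_1 h_bounds(1,2) h_less_q q_minus_p Suc_m_p_less m_q_plus_p_le beta_eq
    top_bound
  have c: "- int m - 1 \<le> c" "c \<le> int m + 1"
    using assms by (auto simp: wide_hexagon_def)
  have cp: "- (m + 1) * p \<le> c * p" "c * p \<le> (m + 1) * p"
    using int_mult_mono[OF c(1) p_pos] int_mult_mono[OF c(2) p_pos] by (simp_all add: algebra_simps)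
  have mq: "m * q \<le> m" using q_less_1 mult_left_mono[of q 1 "real m"] by simp
  have "\<beta> * t - h < \<delta> \<and> \<delta> \<le> \<beta> * (t + 1) - h"
  proof -
    consider "b = int m + 1" "0 \<le> c" "c \<le> int m" | "1 \<le> b" "b \<le> int m" "b - int m - 1 \<le> c"
      | "b = 0" | "b = -1" "c \<le> -1" | "b = -1" "c \<ge> 0"
      | "- int m \<le> b" "b \<le> -2" "c \<le> b + int m + 1" | "b = - int m - 1" "c \<le> 0" "b \<le> -2"
      using assms m_pos unfolding wide_hexagon_def mem_Collect_eq prod.case by smt
    then show ?thesis
    proof cases
      case 1
      have "t = 1" using 1 by (simp add: t_def correction_def)
      moreover have "c * p \<le> int m * p" using 1 by (intro int_mult_mono p_pos) simp
      moreover have "of_int (0) * p \<le> c * p" using 1 by (intro int_mult_mono p_pos) simp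
      ultimately show ?thesis using 1(1) bd mq m_ge_1 unfolding \<delta>_def by (simp add: algebra_simps)
    next
      case 2
      have "t = 0" using 2 by (simp add: t_def correction_def)
      moreover have "of_int (b - int m - 1) * p \<le> c * p" using 2 by (intro int_mult_mono p_pos) simp
      moreover have "b * (q - p) \<le> int m * (q - p)" using 2 by (intro int_mult_mono q_minus_p) simp
      moreover have "of_int (1) * q \<le> b * q" using 2 by (intro int_mult_mono q_pos) simp
      ultimately show ?thesis using bd mq cp unfolding \<delta>_def by (simp add: algebra_simps)
    next
      case 3
      have "t = 0" using 3 by (simp add: t_def correction_def)
      then show ?thesis using 3 bd mq cp m_ge_1 unfolding \<delta>_def by (simp add: algebra_simps)
    next
      case 4
      have "t = 0" using 4 by (simp add: t_def correction_def)
      moreover have "c * p \<le> of_int (-1) * p" using 4 by (intro int_mult_mono p_pos) simp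
      ultimately show ?thesis using 4(1) bd mq cp m_ge_1 unfolding \<delta>_def by (simp add: algebra_simps)
    next
      case 5
      have "t = -1" using 5 by (simp add: t_def correction_def)
      moreover have "of_int (0) * p \<le> c * p" using 5 by (intro int_mult_mono p_pos) simp
      ultimately show ?thesis using 5(1) bd mq cp m_ge_1 unfolding \<delta>_def by (simp add: algebra_simps)
    next
      case 6
      have "t = -1" using 6 by (simp add: t_def correction_def)
      moreover have "b * q \<le> of_int (-2) * q" using 6 by (intro int_mult_mono q_pos) simp
      moreover have "of_int (- int m) * (q - p) \<le> b * (q - p)" using 6 by (intro int_mult_mono q_minus_p) simp
      moreover have "c * p \<le> of_int (b + int m + 1) * p" using 6 by (intro int_mult_mono p_pos) simp
      ultimately show ?thesis using bd mq cp m_ge_1 unfolding \<delta>_def by (simp add: algebra_simps)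
    next
      case 7
      have b: "b * q = - m * q - q" unfolding 7(1) by (simp add: algebra_simps)
      have "t = -1" using 7 by (simp add: t_def correction_def)
      moreover have "b * q \<le> of_int (-2) * q" using 7 by (intro int_mult_mono q_pos) simp
      moreover have "c * p \<le> of_int (0) * p" using 7 by (intro int_mult_mono p_pos) simp
      ultimately show ?thesis using b bd mq cp m_ge_1 unfolding \<delta>_def by (simp add: algebra_simps)
    qed
  qed
  moreover have "\<beta> * (h - 1) = - h"
    using h_bounds(3) by (simp add: algebra_simps)
  ultimately have "\<not> lin b c (t - b + c) < - h" "lin b c (t - b + c) < 1 - h"
    unfolding lin_less_iff \<delta>_def using h_bounds(3) by (simp_all add: algebra_simps)
  then show ?thesis by (simp add: ell_eq t_def)
qed

text \<open>Two values in the interval that share \<open>b\<close> and \<open>c\<close> differ by an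
  integer of modulus less than 1.\<close>

lemma lin_in_unit_ivl_imp:
  assumes "(b, c) \<in> wide_hexagon (int m)" "lin b c e \<in> unit_ivl \<beta>"
  shows "b - c + e = correction (int m) b c"
proof -
  have "\<bar>lin b c e - lin b c (correction (int m) b c - b + c)\<bar> < 1"
    using lin_correction_in_unit_ivl[OF assms(1)] assms(2) by auto
  then have "\<bar>of_int (e - (correction (int m) b c - b + c))\<bar> < (1::real)"
    by (simp add: lin_def)
  then show ?thesis by linarith
qed

section \<open>The upper bound\<close>

lemma neg_beta_T_lin:
  "lin b c e \<in> unit_ivl \<beta> \<Longrightarrow> neg_beta_T \<beta> (lin a b c) = lin b c e"
  by (rule neg_beta_T_eqI[OF neg_beta_lin])

definition state :: "int \<times> int \<Rightarrow> real" where
  "state = (\<lambda>(a, b). lin a b (correction (int m) a b - a + b))"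

lemma state_shift_map:
  assumes "v \<in> hexagon (int m)"
  shows "neg_beta_T \<beta> (state v) = state (shift_map (int m) v) \<and> shift_map (int m) v \<in> hexagon (int m)"
proof -
  obtain a b where v: "v = (a, b)" by force
  have *: "(b, correction (int m) a b - a + b) \<in> hexagon (int m)"
    using hexagon_step[of "int m" a b] assms v m_pos by simp
  then have **: "(b, correction (int m) a b - a + b) \<in> wide_hexagon (int m)"
    using hexagon_subset[of "int m"] m_pos by auto
  show ?thesis
    using * neg_beta_T_lin[OF lin_correction_in_unit_ivl[OF **]] v
    by (simp add: state_def shift_map_def)
qed

lemma state_shift_map_pow:
  assumes "v \<in> hexagon (int m)"
  shows "(neg_beta_T \<beta> ^^ n) (state v) = state ((shift_map (int m) ^^ n) v) \<and>
    (shift_map (int m) ^^ n) v \<in> hexagon (int m)"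
  using assms state_shift_map by (induction n) auto

lemma state_0 [simp]: "state (0, 0) = 0"
  by (simp add: state_def correction_def)

lemma neg_beta_T_digit:
  assumes "x \<in> unit_ivl \<beta>"
  shows "\<exists>d. neg_beta_T \<beta> x = - \<beta> * x - of_int d \<and> 0 \<le> d \<and> d \<le> int m"
proof (intro exI conjI)
  have "x < 1 - h" "- h \<le> x" using assms by (auto simp: ell_eq)
  then have "\<beta> * x < \<beta> * (1 - h)" "\<beta> * - h \<le> \<beta> * x"
    using beta_gt_1 by (intro mult_strict_left_mono mult_left_mono; simp)+
  then have "\<beta> * x < h" "h - \<beta> \<le> \<beta> * x"
    using h_bounds(3) by (auto simp: algebra_simps)
  then have "0 \<le> - \<beta> * x - ell \<beta>" "- \<beta> * x - ell \<beta> < m + 1"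
    using beta_eq q_less_1 by (auto simp: ell_eq)
  then show "0 \<le> \<lfloor>- \<beta> * x - ell \<beta>\<rfloor>" "\<lfloor>- \<beta> * x - ell \<beta>\<rfloor> \<le> int m"
    by linarith+
qed (simp add: neg_beta_T_def)

lemma neg_beta_T_pow_diff:
  assumes "x \<in> unit_ivl \<beta>" "y \<in> unit_ivl \<beta>" "z \<in> unit_ivl \<beta>" "x = y + z"
  shows "\<exists>a b c. (a, b, c) \<in> sum_region (int m) \<and>
    (neg_beta_T \<beta> ^^ n) x - (neg_beta_T \<beta> ^^ n) y - (neg_beta_T \<beta> ^^ n) z = lin a b c"
proof (induction n)
  case 0
  have "(0, 0, 0) \<in> sum_region (int m)"
    by (simp add: sum_region_def)
  then show ?case using assms(4) by (metis (no_types) add_diff_cancel_left' diff_self funpow_0 lin_0)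
next
  case (Suc n)
  define T where "T = neg_beta_T \<beta>"
  obtain a b c where abc: "(a, b, c) \<in> sum_region (int m)"
    and eq: "(T ^^ n) x - (T ^^ n) y - (T ^^ n) z = lin a b c"
    using Suc unfolding T_def by blast
  have rng: "(T ^^ n) x \<in> unit_ivl \<beta>" "(T ^^ n) y \<in> unit_ivl \<beta>" "(T ^^ n) z \<in> unit_ivl \<beta>"
    unfolding T_def using assms(1-3) by (simp_all only: neg_beta_T_pow_range)
  obtain i where i: "T ((T ^^ n) x) = - \<beta> * (T ^^ n) x - of_int i" "0 \<le> i" "i \<le> int m"
    using neg_beta_T_digit[OF rng(1)] unfolding T_def by blast
  obtain j where j: "T ((T ^^ n) y) = - \<beta> * (T ^^ n) y - of_int j" "0 \<le> j" "j \<le> int m"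
    using neg_beta_T_digit[OF rng(2)] unfolding T_def by blast
  obtain k where k: "T ((T ^^ n) z) = - \<beta> * (T ^^ n) z - of_int k" "0 \<le> k" "k \<le> int m"
    using neg_beta_T_digit[OF rng(3)] unfolding T_def by blast
  \<comment> \<open>This makes the integer split off in \<open>neg_beta_lin\<close> equal to
    \<open>i - j - k\<close>.\<close>
  define e where "e = - int m * (a - b + c) - (i - j - k)"
  have "T ((T ^^ n) x) - T ((T ^^ n) y) - T ((T ^^ n) z) = - \<beta> * lin a b c - of_int (i - j - k)"
    unfolding i j k eq[symmetric] by (simp add: algebra_simps)
  also have "\<dots> = lin b c e"
    unfolding neg_beta_lin[of a b c e] e_def by simp
  finally have eq': "T ((T ^^ n) x) - T ((T ^^ n) y) - T ((T ^^ n) z) = lin b c e" .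
  have "T w \<in> unit_ivl \<beta>" for w unfolding T_def by (rule neg_beta_T_range)
  then have lin: "h - 2 < lin b c e" "lin b c e < h + 1"
    unfolding eq'[symmetric] by (simp_all add: ell_eq) (smt (verit))+
  have bd: "- int m \<le> b" "b \<le> int m + 1" "- int m - 1 \<le> c" "c \<le> int m + 1"
    "c - b \<le> int m + 1" "b - c \<le> int m + 1"
    using abc m_pos by (auto simp: sum_region_def split: if_splits)
  note wide = lin_wide_window[OF bd lin]
  have "- int m * (a - b + c) - int m \<le> e" "e \<le> - int m * (a - b + c) + 2 * int m"
    using i(2,3) j(2,3) k(2,3) unfolding e_def by linarith+
  then have "(b, c, e) \<in> sum_region (int m)"
    using m_pos by (intro sum_region_step[OF _ abc] wide) simp_all
  then show ?case using eq' unfolding T_def by auto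
qed

text \<open>For \<open>x - y\<close> the roles are exchanged: \<open>x = y + (x - y)\<close>.\<close>

lemma frac_state_sum_diff:
  assumes x: "x \<in> neg_beta_integers \<beta>" and y: "y \<in> neg_beta_integers \<beta>"
    and u: "u = x + y \<or> u = x - y"
  shows "\<exists>n v. u / (- \<beta>) ^ n \<in> open_ivl \<beta> \<and> v \<in> hexagon (int m) \<and> frac_state \<beta> n u = state v"
proof -
  obtain i j k where ijk: "\<forall>n\<ge>i. x / (- \<beta>) ^ n \<in> open_ivl \<beta>"
    "\<forall>n\<ge>j. y / (- \<beta>) ^ n \<in> open_ivl \<beta>" "\<forall>n\<ge>k. u / (- \<beta>) ^ n \<in> open_ivl \<beta>"
    using ex_scaling_into_open_ivl[OF beta_gt_1] by meson
  define n where "n = i + j + k"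
  have n: "x / (- \<beta>) ^ n \<in> open_ivl \<beta>" "y / (- \<beta>) ^ n \<in> open_ivl \<beta>"
    "u / (- \<beta>) ^ n \<in> open_ivl \<beta>"
    using ijk unfolding n_def by simp_all
  have 0: "frac_state \<beta> n x = 0" "frac_state \<beta> n y = 0"
    using x y neg_beta_integers_iff[OF beta_gt_1] n by auto
  have rng: "frac_state \<beta> n u \<in> unit_ivl \<beta>" using frac_state_range n(3) by blast
  from u have "\<exists>v. v \<in> hexagon (int m) \<and> frac_state \<beta> n u = state v"
  proof
    assume "u = x + y"
    then have "u / (- \<beta>) ^ n = x / (- \<beta>) ^ n + y / (- \<beta>) ^ n"
      by (simp add: add_divide_distrib)
    then have "\<exists>a b c. (a, b, c) \<in> sum_region (int m) \<and>
        frac_state \<beta> n u - frac_state \<beta> n x - frac_state \<beta> n y = lin a b c"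
      unfolding frac_state_def using n by (intro neg_beta_T_pow_diff) auto
    then obtain a b c where abc: "(a, b, c) \<in> sum_region (int m)" "frac_state \<beta> n u = lin a b c"
      using 0 by auto
    then have t: "a - b + c = correction (int m) a b"
      using rng m_pos by (intro lin_in_unit_ivl_imp sum_region_wide_hexagon[of _ a b c]) auto
    then have "correction (int m) a b - a + b = c" by simp
    then show ?thesis
      using abc sum_region_hexagon[OF _ abc(1) t] m_pos
      by (intro exI[of _ "(a, b)"]) (simp add: state_def)
  next
    assume "u = x - y"
    then have "x / (- \<beta>) ^ n = y / (- \<beta>) ^ n + u / (- \<beta>) ^ n"
      by (simp add: diff_divide_distrib)
    then have "\<exists>a b c. (a, b, c) \<in> sum_region (int m) \<and>
        frac_state \<beta> n x - frac_state \<beta> n y - frac_state \<beta> n u = lin a b c"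
      unfolding frac_state_def using n by (intro neg_beta_T_pow_diff) auto
    then obtain a b c where abc: "(a, b, c) \<in> sum_region (int m)" "- frac_state \<beta> n u = lin a b c"
      using 0 by auto
    \<comment> \<open>The window found belongs to the negative of the state, so it is reflected in
      the origin and the lemmas on the reflected region apply.\<close>
    define a' b' c' where "a' = - a" "b' = - b" "c' = - c"
    then have abc': "(- a', - b', - c') \<in> sum_region (int m)" "frac_state \<beta> n u = lin a' b' c'"
      using abc lin_uminus[of a b c] by auto
    then have t: "a' - b' + c' = correction (int m) a' b'"
      using rng m_pos by (intro lin_in_unit_ivl_imp neg_sum_region_wide_hexagon[of _ a' b' c']) auto
    then have "correction (int m) a' b' - a' + b' = c'" by simp
    then show ?thesis
      using abc' neg_sum_region_hexagon[OF _ abc'(1) t] m_pos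
      by (intro exI[of _ "(a', b')"]) (simp add: state_def)
  qed
  then show ?thesis using n(3) by blast
qed

definition max_len :: nat where
  "max_len = 3 * m + (if m = 1 \<or> even m then 3 else 4)"

lemma fr_sum_diff_le:
  assumes "x \<in> neg_beta_integers \<beta>" "y \<in> neg_beta_integers \<beta>" "u = x + y \<or> u = x - y"
  shows "finite_neg_beta_expansion \<beta> u \<and> fr \<beta> u \<le> max_len"
proof -
  obtain n v where n: "u / (- \<beta>) ^ n \<in> open_ivl \<beta>"
    and v: "v \<in> hexagon (int m)" "frac_state \<beta> n u = state v"
    using frac_state_sum_diff[OF assms] by blast
  have "int max_len = 3 * int m + (if int m = 1 \<or> even (int m) then 3 else 4)"
    unfolding max_len_def by simp
  then have "(shift_map (int m) ^^ max_len) v = (0, 0)"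
    using shift_map_pow_eq_0[of "int m" "fst v" "snd v"] v(1) m_pos by simp
  then have "(neg_beta_T \<beta> ^^ max_len) (frac_state \<beta> n u) = 0"
    using state_shift_map_pow[OF v(1), of max_len] v(2) by simp
  then show ?thesis using finite_expansion_fr_le[OF beta_gt_1 n] by blast
qed

text \<open>The state of \<open>(-1, 0)\<close> is \<open>- m / \<beta>\<close>, nonzero and mapped
  to 0, so the last nonzero digit stands one place after the time at which this pair is
  reached.\<close>

lemma fr_eq_max_len:
  assumes "u / (- \<beta>) ^ n \<in> open_ivl \<beta>" "frac_state \<beta> n u = state v" "v \<in> hexagon (int m)"
    and "(shift_map (int m) ^^ (max_len - 1)) v = (-1, 0)"
  shows "fr \<beta> u = max_len"
proof -
  obtain N where N: "max_len = Suc N"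
    using m_pos by (cases max_len) (auto simp: max_len_def)
  have "(neg_beta_T \<beta> ^^ N) (frac_state \<beta> n u) = state (-1, 0)"
    using state_shift_map_pow[OF assms(3)] assms(2,4) N by simp
  moreover have "state (-1, 0) \<noteq> 0"
    using m_pos beta_gt_1 beta_eq q_pos by (simp add: state_def correction_def lin_def field_simps)
  moreover have "neg_beta_T \<beta> (state (-1, 0)) = 0"
    using state_shift_map[of "(-1, 0)"] m_pos by (simp add: hexagon_def shift_map_def correction_def)
  ultimately show ?thesis
    using fr_eq_Suc[OF beta_gt_1 assms(1), of N] N by simp
qed

section \<open>The lower bound\<close>

text \<open>The inverse branch of the transformation that belongs to the digit
  \<open>d\<close>.\<close>

definition prepend :: "int \<Rightarrow> real \<Rightarrow> real" where
  "prepend d v = (of_int d + v) / - \<beta>"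

text \<open>A digit \<open>m\<close> may be followed by a positive digit or by two zeros; the flag \<open>s\<close> says whether the
  state after the last digit is small enough for this digit to be \<open>m\<close>. This sufficient condition is
  stronger than admissibility in the usual sense.\<close>

fun admissible :: "bool \<Rightarrow> int list \<Rightarrow> bool" where
  "admissible s [] = True"
| "admissible s (d # ds) \<longleftrightarrow> 0 \<le> d \<and> d \<le> int m \<and> admissible s ds \<and>
     (d < int m \<or> (case ds of [] \<Rightarrow> s | e # es \<Rightarrow> e \<ge> 1 \<or> es \<noteq> [] \<and> hd es = 0))"

text \<open>The image stays above \<open>ell \<beta>\<close> iff \<open>d + v < \<beta> - h\<close>;
  for \<open>d = m\<close> this is \<open>v < q - h\<close>.\<close>

lemma prepend_open_ivl:
  assumes "v \<in> open_ivl \<beta>" "0 \<le> d" "d \<le> int m" "d < int m \<or> v < q - h"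
  shows "prepend d v \<in> open_ivl \<beta>"
proof -
  have v: "- h < v" "v < 1 - h" using assms(1) by (auto simp: ell_eq)
  have "d + v < \<beta> - h"
    using assms(4)
  proof
    assume "d < int m"
    then have "real_of_int d \<le> real m - 1" by linarith
    then show ?thesis using v beta_eq q_pos by linarith
  next
    assume "v < q - h"
    moreover have "real_of_int d \<le> m" using assms(3) by linarith
    ultimately show ?thesis using beta_eq by linarith
  qed
  moreover have "- h < d + v" using v assms(2) by (simp add: add_strict_increasing2)
  moreover have "\<beta> * (1 - h) = h" using h_bounds(3) by (simp add: algebra_simps)
  ultimately show ?thesis
    using h_bounds(3) beta_gt_1 by (simp add: prepend_def ell_eq field_simps)
qed

lemma prepend_neg:
  assumes "v \<in> open_ivl \<beta>" "1 \<le> d"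
  shows "prepend d v < 0"
proof -
  have "0 < d + v" using assms h_bounds(2) ell_eq by (simp add: add_strict_increasing2)
  then show ?thesis using beta_gt_1 by (simp add: prepend_def)
qed

lemma square_q_minus_h: "\<beta>\<^sup>2 * (q - h) = m * h"
proof -
  have *: "(\<beta> + 1) * (\<beta>\<^sup>2 * q) = m * (\<beta> + 1)\<^sup>2" "(\<beta> + 1) * h = \<beta>"
    using beta_gt_1 by (simp_all add: q_eq p_def h_def power2_eq_square)
  have "(\<beta> + 1) * (\<beta>\<^sup>2 * (q - h)) = (\<beta> + 1) * (\<beta>\<^sup>2 * q) - \<beta>\<^sup>2 * ((\<beta> + 1) * h)"
    by (simp add: algebra_simps)
  also have "\<dots> = m * (\<beta> + 1)\<^sup>2 - \<beta> ^ 3"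
    unfolding * by (simp add: power2_eq_square power3_eq_cube)
  also have "\<dots> = m * ((\<beta> + 1) * h)"
    unfolding cube * by (simp add: algebra_simps power2_eq_square)
  also have "\<dots> = (\<beta> + 1) * (m * h)"
    by simp
  finally show ?thesis
    using beta_gt_1 by simp
qed

lemma h_le: "h \<le> \<beta>\<^sup>2 * (q - h)"
  unfolding square_q_minus_h using m_ge_1 h_bounds(1) mult_right_mono[of 1 "real m" h] by simp

text \<open>Two zeros divide by \<open>\<beta> * \<beta>\<close>, and
  \<open>v < 1 - h < h \<le> \<beta>\<^sup>2 * (q - h)\<close>.\<close>

lemma prepend_0_0:
  assumes "v \<in> open_ivl \<beta>"
  shows "prepend 0 (prepend 0 v) < q - h"
proof -
  have "v < \<beta>\<^sup>2 * (q - h)"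
    using assms h_le h_bounds(1) by (auto simp: ell_eq)
  also have "v = \<beta>\<^sup>2 * prepend 0 (prepend 0 v)"
    using beta_gt_1 by (simp add: prepend_def power2_eq_square)
  finally show ?thesis
    using beta_gt_1 by (simp only: mult_less_cancel_left_pos zero_less_power)
qed

text \<open>The induction is on length because a digit \<open>m\<close> followed by two zeros
  appeals to the tail behind these zeros.\<close>

lemma foldr_prepend_open_ivl:
  assumes "v \<in> open_ivl \<beta>" "s \<Longrightarrow> v < q - h"
  shows "admissible s ds \<Longrightarrow> foldr prepend ds v \<in> open_ivl \<beta>"
proof (induction ds rule: length_induct)
  case (1 ds)
  then have IH: "foldr prepend es v \<in> open_ivl \<beta>"
    if "length es < length ds" "admissible s es" for es
    using that by blast
  show ?case
  proof (cases ds)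
    case Nil
    then show ?thesis using assms by simp
  next
    case ds: (Cons d es)
    then have d: "0 \<le> d" "d \<le> int m" "admissible s es" using 1(2) by auto
    have "d < int m \<or> foldr prepend es v < q - h"
    proof (cases es)
      case Nil
      then show ?thesis using 1(2) ds assms(2) by auto
    next
      case es: (Cons e fs)
      have fs: "foldr prepend fs v \<in> open_ivl \<beta>"
        using d(3) es ds by (intro IH) auto
      consider "d < int m" | "e \<ge> 1" | gs where "fs = 0 # gs" "\<not> e \<ge> 1"
        using 1(2) ds es by (cases fs) auto
      then show ?thesis
      proof cases
        case 2
        then have "foldr prepend es v < 0" using prepend_neg[OF fs] es by simp
        then show ?thesis using h_less_q by simp
      next
        case 3
        then have "e = 0" using d(3) es by simp
        have "foldr prepend gs v \<in> open_ivl \<beta>"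
          using d(3) es ds 3 by (intro IH) auto
        then show ?thesis using prepend_0_0 es 3 \<open>e = 0\<close> by simp
      qed simp
    qed
    then show ?thesis using prepend_open_ivl[OF IH[of es] d(1,2)] d(3) ds by simp
  qed
qed

lemma neg_beta_T_prepend:
  "v \<in> unit_ivl \<beta> \<Longrightarrow> neg_beta_T \<beta> (prepend d v) = v"
  using beta_gt_1 by (intro neg_beta_T_eqI[of _ _ d]) (auto simp: prepend_def)

lemma neg_beta_T_pow_foldr_prepend:
  assumes "v \<in> open_ivl \<beta>" "s \<Longrightarrow> v < q - h"
  shows "admissible s ds \<Longrightarrow> (neg_beta_T \<beta> ^^ length ds) (foldr prepend ds v) = v"
proof (induction ds)
  case (Cons d ds)
  then have "foldr prepend ds v \<in> unit_ivl \<beta>"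
    using foldr_prepend_open_ivl[OF assms, of s ds] by auto
  then show ?case
    using Cons by (simp add: funpow_Suc_right neg_beta_T_prepend del: funpow.simps)
qed simp

section \<open>Three digit strings read in parallel\<close>

abbreviation "z_digits \<equiv> map (\<lambda>t. fst (snd t))"
abbreviation "x_digits \<equiv> map (\<lambda>t. fst (snd (snd t)))"
abbreviation "y_digits \<equiv> map (\<lambda>t. snd (snd (snd t)))"

text \<open>An entry \<open>(e, i, j, k)\<close> extends the window \<open>(a, b, c)\<close> to \<open>(b, c, e)\<close>; the digits \<open>i, j, k\<close> are
  those of \<open>z, x, y\<close>, where \<open>lin a b c\<close> is the current value of \<open>z - x + y\<close>.\<close>

fun path :: "int \<times> int \<times> int \<Rightarrow> (int \<times> int \<times> int \<times> int) list \<Rightarrow> int \<times> int \<times> int \<Rightarrow> bool" where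
  "path w [] w' \<longleftrightarrow> w' = w"
| "path (a, b, c) ((e, i, j, k) # r) w' \<longleftrightarrow>
     i - j + k = - int m * (a - b + c) - e \<and> path (b, c, e) r w'"

lemma prepend_combination:
  "prepend i z - prepend j x + prepend k y = (of_int i + z - (of_int j + x) + (of_int k + y)) / - \<beta>"
  by (simp add: prepend_def diff_divide_distrib add_divide_distrib)

text \<open>Each entry undoes one use of \<open>neg_beta_lin\<close>: the digit combination is
  exactly the integer split off there.\<close>

lemma path_foldr_prepend:
  assumes "path (a, b, c) r (a', b', c')" "z - x + y = lin a' b' c'"
  shows "foldr prepend (z_digits r) z - foldr prepend (x_digits r) x
    + foldr prepend (y_digits r) y = lin a b c"
  using assms(1)
proof (induction r arbitrary: a b c)
  case Nil
  then show ?case using assms(2) by simp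
next
  case (Cons t r)
  obtain e i j k where t: "t = (e, i, j, k)" by (cases t) auto
  let ?z = "foldr prepend (z_digits r) z"
  let ?x = "foldr prepend (x_digits r) x"
  let ?y = "foldr prepend (y_digits r) y"
  have digits: "i - j + k = - int m * (a - b + c) - e" and "path (b, c, e) r (a', b', c')"
    using Cons.prems t by simp_all
  then have "?z - ?x + ?y = lin b c e" by (intro Cons.IH)
  then have "of_int i + ?z - (of_int j + ?x) + (of_int k + ?y) = of_int (i - j + k) + lin b c e"
    by simp
  also have "\<dots> = - \<beta> * lin a b c"
    unfolding digits neg_beta_lin[of a b c e] ..
  finally have "prepend i ?z - prepend j ?x + prepend k ?y = lin a b c"
    using beta_gt_1 by (simp add: prepend_combination)
  then show ?case
    by (simp add: t)
qed

text \<open>For \<open>w = (0, 0, 0)\<close> the equation reads \<open>z = x - y\<close>. Scaling by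
  \<open>(- \<beta>) ^ n\<close> then turns \<open>x\<close> and \<open>y\<close> into
  (-\<beta>)-integers whose difference has fractional state \<open>s\<close>.\<close>

definition reach :: "int \<times> int \<times> int \<Rightarrow> real \<Rightarrow> bool" where
  "reach w s \<longleftrightarrow> (\<exists>n x y z. x \<in> open_ivl \<beta> \<and> y \<in> open_ivl \<beta> \<and> z \<in> open_ivl \<beta> \<and>
     (neg_beta_T \<beta> ^^ n) x = 0 \<and> (neg_beta_T \<beta> ^^ n) y = 0 \<and> (neg_beta_T \<beta> ^^ n) z = s \<and>
     z - x + y = (case w of (a, b, c) \<Rightarrow> lin a b c))"

lemma reach_path:
  assumes "path w r w'"
    and "admissible f (z_digits r)" "admissible g (x_digits r)"
      "admissible g (y_digits r)"
    and xyz: "x \<in> open_ivl \<beta>" "y \<in> open_ivl \<beta>" "z \<in> open_ivl \<beta>"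
      "(neg_beta_T \<beta> ^^ n) x = 0" "(neg_beta_T \<beta> ^^ n) y = 0" "(neg_beta_T \<beta> ^^ n) z = s"
      "z - x + y = (case w' of (a, b, c) \<Rightarrow> lin a b c)"
    and small: "f \<Longrightarrow> z < q - h" "g \<Longrightarrow> x < q - h" "g \<Longrightarrow> y < q - h"
  shows "reach w s"
proof -
  obtain a b c a' b' c' where w: "w = (a, b, c)" "w' = (a', b', c')"
    by (cases w, cases w') auto
  have pow: "(neg_beta_T \<beta> ^^ (n + length r)) u = (neg_beta_T \<beta> ^^ n) ((neg_beta_T \<beta> ^^ length r) u)" for u
    by (simp add: funpow_add)
  show ?thesis
    unfolding reach_def w
    using foldr_prepend_open_ivl[OF xyz(1) small(2) assms(3)] foldr_prepend_open_ivl[OF xyz(2) small(3) assms(4)]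
      foldr_prepend_open_ivl[OF xyz(3) small(1) assms(2)]
      neg_beta_T_pow_foldr_prepend[OF xyz(1) small(2) assms(3)]
      neg_beta_T_pow_foldr_prepend[OF xyz(2) small(3) assms(4)]
      neg_beta_T_pow_foldr_prepend[OF xyz(3) small(1) assms(2)]
      path_foldr_prepend[of a b c r a' b' c' z x y] assms(1) xyz w
    by (intro exI[of _ "n + length r"] exI[of _ "foldr prepend (x_digits r) x"]
        exI[of _ "foldr prepend (y_digits r) y"]
        exI[of _ "foldr prepend (z_digits r) z"]) (simp only: pow length_map prod.case simp_thms)
qed

lemma reach_prepend_path:
  assumes "path w r w'" "reach w' s"
    and "admissible False (z_digits r)" "admissible False (x_digits r)"
      "admissible False (y_digits r)"
  shows "reach w s"
  using assms(2) unfolding reach_def[of w'] using reach_path[OF assms(1,3-5)] by blast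

text \<open>The innermost piece starts from \<open>x = y = 0\<close>. As \<open>0 < q - h\<close>,
  the digits of \<open>x\<close> and \<open>y\<close> may end in \<open>m\<close>.\<close>

lemma reach_final:
  assumes "path w r (a, b, c)" "lin a b c \<in> open_ivl \<beta>" "f \<Longrightarrow> lin a b c < q - h"
    and "admissible f (z_digits r)" "admissible True (x_digits r)"
      "admissible True (y_digits r)"
  shows "reach w (lin a b c)"
  using assms(2,3) h_bounds h_less_q
  by (intro reach_path[OF assms(1,4-6), of 0 0 "lin a b c" 0]) (auto simp: ell_eq)

text \<open>One block of six digits joins \<open>(0, 2 * l - 2, 2 * l - 3)\<close> to
  \<open>(0, 2 * l, 2 * l - 1)\<close>; its digit \<open>2 * l\<close> requires
  \<open>2 * l \<le> m\<close>.\<close>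

lemma reach_spiral:
  assumes "m \<ge> 2" "2 * k \<le> m" "reach (0, 2 * int k, 2 * int k - 1) s"
  shows "reach (0, 0, -1) s"
  using assms(2,3)
proof (induction k)
  case (Suc k)
  define l where "l = int k + 1"
  have l: "1 \<le> l" "2 * l \<le> int m" using Suc.prems by (simp_all add: l_def)
  have reach: "reach (0, 2 * l, 2 * l - 1) s" using Suc.prems by (simp add: l_def algebra_simps)
  \<comment> \<open>The final zeros of \<open>z\<close> and \<open>y\<close> permit the digits
    \<open>m\<close> before them, and no string ends in \<open>m\<close>, so blocks can be
    concatenated.\<close>
  define r where "r = [(-2, int m, 0, 2), (- 2 * l, int m, 0, 2 * l), (- 2 * l, int m, 0, 2 * l),
    (0, int m, 0, int m), (2 * l, 0, 2 * l, 0), (2 * l - 1, 0, 2 * l - 1, 0)]"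
  have path: "path (0, 2 * l - 2, 2 * l - 3) r (0, 2 * l, 2 * l - 1)"
    unfolding r_def by simp
  have adm: "admissible False (z_digits r)" "admissible False (x_digits r)"
    "admissible False (y_digits r)"
    unfolding r_def using l assms(1) by simp_all
  have "reach (0, 2 * l - 2, 2 * l - 3) s"
    by (rule reach_prepend_path[OF path reach adm])
  then show ?case using Suc by (simp add: l_def)
qed simp

text \<open>The target pair has potential \<open>3 * m + 3\<close>, the maximum for even
  \<open>m\<close>. The digits of \<open>z\<close> end in \<open>m\<close>, so its state must be
  below \<open>q - h\<close>; it is only \<open>p * q / \<beta>\<close>.\<close>

lemma reach_even:
  assumes "even m"
  shows "reach (0, 0, -1) (state (-1, - int m - 1))"
proof -
  obtain k where k: "m = 2 * k" using assms by blast
  have m: "m \<ge> 2" using k m_pos by simp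
  define \<sigma> where "\<sigma> = lin (-1) (- int m - 1) (- int m)"
  have "p * q = p * \<beta> - p * m" "q = p * \<beta> + p"
    by (simp_all add: q_def right_diff_distrib flip: q_eq) (simp add: q_eq algebra_simps flip: q_def)
  then have "q - (m + 1) * p = p * q"
    by (simp add: algebra_simps)
  then have \<sigma>: "\<sigma> = p * q / \<beta>"
    unfolding \<sigma>_def lin_eq by (simp add: algebra_simps minus_divide_left)
  moreover have "q - p = p * \<beta>" by (simp add: q_eq algebra_simps)
  ultimately have "\<beta>\<^sup>2 * \<sigma> = q * (q - p)"
    using beta_gt_1 by (simp add: power2_eq_square)
  also have "\<dots> \<le> 1 * (q - p)"
    using q_less_1 q_minus_p by (intro mult_right_mono) auto
  also have "\<dots> < h" using q_minus_p by simp
  finally have "\<beta>\<^sup>2 * \<sigma> < \<beta>\<^sup>2 * (q - h)"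
    using h_le by simp
  then have "\<sigma> < q - h" using beta_gt_1 by simp
  moreover have "0 < \<sigma>" using \<sigma> p_pos q_pos beta_gt_1 by simp
  moreover from calculation have "\<sigma> \<in> open_ivl \<beta>"
    using h_bounds q_less_1 by (simp add: ell_eq)
  ultimately have "reach (0, int m, int m - 1) \<sigma>"
    unfolding \<sigma>_def using m
    by (intro reach_final[where f = True and r = "[(-1, int m, 0, 1), (- int m - 1, int m, 0, 1),
          (- int m, int m, 0, int m)]"]) (auto simp: algebra_simps)
  then have "reach (0, 0, -1) \<sigma>"
    using reach_spiral[of k \<sigma>] m k by simp
  then show ?thesis by (simp add: state_def correction_def \<sigma>_def)
qed

text \<open>The target pair lies on the side \<open>b - a = m + 1\<close> and has the maximal
  potential \<open>3 * m + 4\<close>.\<close>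

lemma reach_odd:
  assumes "odd m" "m \<ge> 3"
  shows "reach (0, 0, -1) (state (-2, int m - 1))"
proof -
  define k where "k = (m - 3) div 2"
  have k: "m = 2 * k + 3" using assms unfolding k_def by presburger
  define \<sigma> where "\<sigma> = lin (-2) (int m - 1) (int m)"
  have \<sigma>: "\<sigma> = state (-2, int m - 1)" by (simp add: \<sigma>_def state_def correction_def)
  have "(-2, int m - 1) \<in> wide_hexagon (int m)"
    using assms by (simp add: wide_hexagon_def)
  then have "\<sigma> \<in> unit_ivl \<beta>"
    using lin_correction_in_unit_ivl[of "-2" "int m - 1"] \<sigma> by (simp add: state_def)
  moreover have "- h < \<sigma>"
  proof -
    have "0 \<le> (real m - 1) * p" using m_ge_1 p_pos by simp
    then have "- 2 * q - (real m - 1) * p < - h"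
      using h_less_q q_pos by linarith
    then show ?thesis unfolding \<sigma>_def lin_greater_iff using h_bounds(3) by simp
  qed
  ultimately have "\<sigma> \<in> open_ivl \<beta>" by (auto simp: ell_eq)

  \<comment> \<open>The first five entries are those of the spiral block with
    \<open>2 * l = m - 1\<close>. The sixth takes \<open>e = m\<close> in place of
    \<open>m - 2\<close>, and the path turns towards the target.\<close>
  define r where "r = [(-2, int m, 0, 2), (1 - int m, int m, 0, int m - 1),
    (1 - int m, int m, 0, int m - 1), (0, int m, 0, int m), (int m - 1, 0, int m - 1, 0),
    (int m, 0, int m, 0), (0, 0, int m, 0), (- int m, int m, 0, int m),
    (- int m - 1, int m, 0, 1), (-2, int m, 0, 2), (int m - 1, 1, 0, 0), (int m, 0, int m, 0)]"
  have path: "path (0, int m - 3, int m - 4) r (-2, int m - 1, int m)"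
    unfolding r_def by simp
  have adm: "admissible False (z_digits r)" "admissible True (x_digits r)"
    "admissible True (y_digits r)"
    unfolding r_def using assms(2) by simp_all
  have "reach (0, int m - 3, int m - 4) \<sigma>"
    unfolding \<sigma>_def
    by (rule reach_final[OF path \<open>\<sigma> \<in> open_ivl \<beta>\<close>[unfolded \<sigma>_def] _ adm]) simp
  then have "reach (0, 0, -1) \<sigma>"
    using reach_spiral[of k \<sigma>] k by simp
  then show ?thesis by (simp add: \<sigma>)
qed

section \<open>Differences and sums of maximal fractional length\<close>

lemma ex_difference_with_state:
  assumes "m \<ge> 2" "reach (0, 0, -1) s"
  shows "\<exists>x\<in>neg_beta_integers \<beta>. \<exists>y\<in>neg_beta_integers \<beta>. \<exists>n.
    (x - y) / (- \<beta>) ^ n \<in> open_ivl \<beta> \<and> frac_state \<beta> n (x - y) = s"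
proof -
  \<comment> \<open>A digit 1 of \<open>z\<close> opens the spiral; it is below \<open>m\<close>
    because \<open>m \<ge> 2\<close>, so nothing is required of what follows.\<close>
  have "reach (0, 0, 0) s"
    by (rule reach_prepend_path[OF _ assms(2), where r = "[(-1, 1, 0, 0)]"]) (use assms(1) in simp_all)
  then obtain n x y z where xyz: "x \<in> open_ivl \<beta>" "y \<in> open_ivl \<beta>" "z \<in> open_ivl \<beta>"
      "z - x + y = lin 0 0 0"
    and T: "(neg_beta_T \<beta> ^^ n) x = 0" "(neg_beta_T \<beta> ^^ n) y = 0" "(neg_beta_T \<beta> ^^ n) z = s"
    unfolding reach_def prod.case by (elim exE conjE) (rule that; assumption)
  define P where "P = (- \<beta>) ^ n"
  have P: "P \<noteq> 0" using beta_gt_1 by (simp add: P_def)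
  have scale: "x * P / P = x" "y * P / P = y" "(x * P - y * P) / P = z"
    using P xyz(4) by (simp_all add: diff_divide_distrib)
  show ?thesis
  proof (rule bexI[of _ "x * P"], rule bexI[of _ "y * P"], intro exI[of _ n] conjI)
    show "x * P \<in> neg_beta_integers \<beta>"
      by (subst neg_beta_integers_iff[OF beta_gt_1, of _ n];
          simp only: frac_state_def P_def[symmetric] scale xyz T)
    show "y * P \<in> neg_beta_integers \<beta>"
      by (subst neg_beta_integers_iff[OF beta_gt_1, of _ n];
          simp only: frac_state_def P_def[symmetric] scale xyz T)
    show "(x * P - y * P) / (- \<beta>) ^ n \<in> open_ivl \<beta>" "frac_state \<beta> n (x * P - y * P) = s"
      by (simp_all only: frac_state_def P_def[symmetric] scale xyz T)
  qed
qed

lemma max_len_attained: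
  "\<exists>x\<in>neg_beta_integers \<beta>. \<exists>y\<in>neg_beta_integers \<beta>. fr \<beta> (x + y) = max_len \<or> fr \<beta> (x - y) = max_len"
proof -
  have "m = 1 \<or> even m \<or> odd m \<and> m \<ge> 3" by presburger
  then consider "m = 1" | "even m" | "odd m" "m \<ge> 3" by blast
  then show ?thesis
  proof cases
    case 1
    have m1: "real m = 1" "int m = 1" using 1 by simp_all
    \<comment> \<open>After scaling by \<open>\<beta>\<^sup>2\<close>, \<open>x\<close> becomes 1
      and \<open>y\<close> becomes 1 - \<beta>. Their sum 2 - \<beta> is the state of
      \<open>(0, 1)\<close>, a pair of maximal potential 6.\<close>
    define x where "x = foldr prepend [0, 1] 0"
    define y where "y = foldr prepend [1, 1] 0"
    define s where "s = state (0, 1)"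
    define z where "z = foldr prepend [0, 0] s"
    have s: "s = 2 - \<beta>" by (simp add: s_def state_def correction_def lin_def q_def m1)
    have s_open: "s \<in> open_ivl \<beta>"
      using s q_less_1 h_less_q h_bounds by (simp add: ell_eq q_def m1)
    have 0: "(0::real) \<in> open_ivl \<beta>" "(0::real) < q - h"
      using h_bounds h_less_q by (simp_all add: ell_eq)
    have adm: "admissible True [0, 1]" "admissible True [1, 1]" "admissible False [0, 0]"
      using m_pos by simp_all
    have "x * \<beta>\<^sup>2 \<in> neg_beta_integers \<beta>" "y * \<beta>\<^sup>2 \<in> neg_beta_integers \<beta>"
      using foldr_prepend_open_ivl[OF 0(1) 0(2) adm(1)] foldr_prepend_open_ivl[OF 0(1) 0(2) adm(2)]
        neg_beta_T_pow_foldr_prepend[OF 0(1) 0(2) adm(1)] neg_beta_T_pow_foldr_prepend[OF 0(1) 0(2) adm(2)]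
        neg_beta_integers_iff[OF beta_gt_1, of "x * \<beta>\<^sup>2" 2] neg_beta_integers_iff[OF beta_gt_1, of "y * \<beta>\<^sup>2" 2]
        beta_gt_1 unfolding x_def y_def by (simp_all add: frac_state_def eval_nat_numeral)
    moreover have "fr \<beta> (x * \<beta>\<^sup>2 + y * \<beta>\<^sup>2) = max_len"
    proof (rule fr_eq_max_len)
      have z: "(x * \<beta>\<^sup>2 + y * \<beta>\<^sup>2) / (- \<beta>) ^ 2 = z"
        using beta_gt_1 by (simp add: x_def y_def z_def s prepend_def field_simps power2_eq_square)
      show "(x * \<beta>\<^sup>2 + y * \<beta>\<^sup>2) / (- \<beta>) ^ 2 \<in> open_ivl \<beta>"
        unfolding z z_def using s_open adm(3) by (intro foldr_prepend_open_ivl[where s = False]) simp_all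
      show "frac_state \<beta> 2 (x * \<beta>\<^sup>2 + y * \<beta>\<^sup>2) = state (0, 1)"
        unfolding frac_state_def z z_def
        using neg_beta_T_pow_foldr_prepend[OF s_open _ adm(3)] by (simp add: s_def numeral_2_eq_2)
      show "(0, 1) \<in> hexagon (int m)" by (simp add: hexagon_def m1)
      have "max_len - 1 = 5" unfolding max_len_def using 1 by simp
      moreover have "(shift_map 1 ^^ 5) (0, 1) = (-1, 0)"
        by (simp add: eval_nat_numeral shift_map_def correction_def)
      ultimately show "(shift_map (int m) ^^ (max_len - 1)) (0, 1) = (-1, 0)"
        unfolding m1 by (simp only:)
    qed
    ultimately show ?thesis by blast
  next
    case 2
    then obtain k where k: "m = 2 * k" by (elim evenE)
    then have m2: "m \<ge> 2" using m_pos by simp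
    obtain x y n where xy: "x \<in> neg_beta_integers \<beta>" "y \<in> neg_beta_integers \<beta>"
      "(x - y) / (- \<beta>) ^ n \<in> open_ivl \<beta>" "frac_state \<beta> n (x - y) = state (-1, - int m - 1)"
      using ex_difference_with_state[OF m2 reach_even[OF 2]] by blast
    have "fr \<beta> (x - y) = max_len"
    proof (rule fr_eq_max_len[OF xy(3,4)])
      show "(-1, - int m - 1) \<in> hexagon (int m)" using m_pos by (simp add: hexagon_def)
      define j where "j = k - 1"
      have j: "int m = 2 * int j + 2" using k m_pos by (simp add: j_def)
      \<comment> \<open>Four steps lead to the diagonal point with entries \<open>m - 1\<close>; the
        other \<open>6 * j + 4\<close> are those of \<open>shift_map_pow_diagonal\<close>.\<close>
      have "max_len - 1 = (6 * j + 4) + 4" using 2 j by (simp add: max_len_def)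
      moreover have "(shift_map (int m) ^^ 4) (-1, - int m - 1) = (2 * int j + 1, 2 * int j + 1)"
        using j by (simp add: eval_nat_numeral shift_map_def correction_def)
      ultimately have "(shift_map (int m) ^^ (max_len - 1)) (-1, - int m - 1) =
          (shift_map (int m) ^^ (6 * j + 4)) (2 * int j + 1, 2 * int j + 1)"
        by (simp only: funpow_add o_apply)
      then show "(shift_map (int m) ^^ (max_len - 1)) (-1, - int m - 1) = (-1, 0)"
        using shift_map_pow_diagonal[of j "int m"] j by (simp only:)
    qed
    then show ?thesis using xy by blast
  next
    case 3
    then have m2: "m \<ge> 2" by simp
    obtain x y n where xy: "x \<in> neg_beta_integers \<beta>" "y \<in> neg_beta_integers \<beta>"
      "(x - y) / (- \<beta>) ^ n \<in> open_ivl \<beta>" "frac_state \<beta> n (x - y) = state (-2, int m - 1)"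
      using ex_difference_with_state[OF m2 reach_odd[OF 3]] by blast
    have "fr \<beta> (x - y) = max_len"
    proof (rule fr_eq_max_len[OF xy(3,4)])
      show "(-2, int m - 1) \<in> hexagon (int m)" using 3 by (simp add: hexagon_def)
      obtain j where j: "m = 2 * j + 1" using 3(1) by (elim oddE)
      have "max_len - 1 = 6 * j + 6" unfolding max_len_def using 3 j by simp
      moreover have "int m - 1 = 2 * int j" "2 * int j + 1 \<le> int m" using j by simp_all
      ultimately show "(shift_map (int m) ^^ (max_len - 1)) (-2, int m - 1) = (-1, 0)"
        using shift_map_pow_minus_two[of j "int m"] by (simp only:)
    qed
    then show ?thesis using xy by blast
  qed
qed

end

theorem theorem9:
  fixes \<beta> :: real and m :: nat
  assumes "m \<ge> 1"
    and "\<beta> > 1"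
    and "\<beta> ^ 3 - real m * \<beta> ^ 2 - real m * \<beta> - real m = 0"
  defines "S \<equiv> {fr \<beta> (x + y) | x y. x \<in> neg_beta_integers \<beta> \<and> y \<in> neg_beta_integers \<beta>} \<union>
               {fr \<beta> (x - y) | x y. x \<in> neg_beta_integers \<beta> \<and> y \<in> neg_beta_integers \<beta>}"
  shows "(\<forall>x\<in>neg_beta_integers \<beta>. \<forall>y\<in>neg_beta_integers \<beta>.
            finite_neg_beta_expansion \<beta> (x + y) \<and> finite_neg_beta_expansion \<beta> (x - y)) \<and>
         finite S \<and>
         Max S = 3 * m + (if m = 1 \<or> even m then 3 else 4)"
proof -
  interpret cubic_base \<beta> m
    using assms(1-3) by unfold_locales
  have "S \<subseteq> {..max_len}"
    unfolding S_def using fr_sum_diff_le by blast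
  moreover obtain x y where "x \<in> neg_beta_integers \<beta>" "y \<in> neg_beta_integers \<beta>"
    "max_len = fr \<beta> (x + y) \<or> max_len = fr \<beta> (x - y)"
    using max_len_attained by metis
  then have "max_len \<in> S"
    unfolding S_def Un_iff mem_Collect_eq by blast
  moreover have "finite S"
    using calculation(1) by (rule finite_subset) simp
  ultimately have "finite S" "Max S = max_len"
    by (auto intro!: Max_eqI)
  then show ?thesis
    using fr_sum_diff_le unfolding max_len_def by metis
qed

end
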